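(* There exists a constant $c>1$ (the value $c=15$ is achieved) such that for every $0\le\beta<1$ and every $\gamma<\frac{1-\beta}{c}$ the following holds for all sufficiently large $n$: there exists an explicit function $E:\{0,1\}^n\times\{0,1\}^t\to\{0,1\}^m$ that is an $(n,b,\epsilon)$ strong extractor against quantum storage with $b=\lfloor n^\beta\rfloor$ and $\epsilon=n^{-\gamma}$, with output length $m=n^{\Omega(1)}$ and seed length $t=O(\log n)$. Here the constants implicit in $\Omega(1)$ and $O(\cdot)$ may depend on $\beta$ and $\gamma$ but not on $n$.
   Context: Logarithms are base 2. $U_t$ is the uniform distribution on $\{0,1\}^t$. The min-entropy of a distribution $X$ on $\{0,1\}^n$ is $H_\infty(X)=\min_{a:\Pr[X=a]>0}\log(1/\Pr[X=a])$. An $(n,b)$ quantum encoding is a collection $\{\rho(x)\}_{x\in\{0,1\}^n}$ of density matrices (positive semidefinite, trace 1) on a Hilbert space of dimension $2^b$. A boolean test (boolean POVM) is a pair of positive semidefinite operators $\{E_0,E_1\}$ with $E_0+E_1=I$; on a state $\rho$ it outputs $i$ with probability $\mathrm{Tr}(E_i\rho)$. A test $\epsilon$-distinguishes two states if the probabilities that it outputs $1$ on them differ in absolute value by at least $\epsilon$. Two states are $\epsilon$-indistinguishable if no boolean POVM $\epsilon$-distinguishes them. $E:\{0,1\}^n\times\{0,1\}^t\to\{0,1\}^m$ is a $(k,b,\epsilon)$ strong extractor against quantum storage if for every distribution $X$ on $\{0,1\}^n$ with $H_\infty(X)\ge k$ and every $(n,b)$ quantum encoding $\{\rho(x)\}$,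 the mixed state $U_t\circ E(X,U_t)\circ\rho(X)$ (sample $x\in X$ and $y\in\{0,1\}^t$ uniformly and independently, output $|y,E(x,y)\rangle\langle y,E(x,y)|\otimes\rho(x)$) is $\epsilon$-indistinguishable from $U_{t+m}\circ\rho(X)$ (sample $x\in X$ and independent uniform $w\in\{0,1\}^{t+m}$, output $|w\rangle\langle w|\otimes\rho(x)$). "Explicit" means that the family of functions $E$ (indexed by $n$) is uniformly computable in time polynomial in the input length. *)

theory Defs
  imports
    "HOL-Probability.Probability_Mass_Function"
    "HOL-Library.Landau_Symbols"
    "HOL-Computational_Algebra.Polynomial"
    "Jordan_Normal_Form.Matrix"
begin

section \<open>Classical sources\<close>

definition bitstrings :: "nat \<Rightarrow> bool list set" where
  "bitstrings n = {w. length w = n}"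

text \<open>Used for finitely supported \<open>X\<close> only, so that the minimum exists.\<close>

definition min_entropy :: "'a pmf \<Rightarrow> real" where
  "min_entropy X = Min ((\<lambda>a. log 2 (1 / pmf X a)) ` set_pmf X)"

section \<open>Quantum states and tests\<close>

text \<open>A Hilbert space of dimension \<open>d\<close> is \<open>\<complex>\<^sup>d\<close>, and operators on it are \<open>d \<times> d\<close> complex matrices.
  In the order on \<^typ>\<open>complex\<close>, \<open>0 \<le> z\<close> says that \<open>z\<close> is real and nonnegative; hence
  positive semidefinite matrices are in particular Hermitian.\<close>

definition psd :: "nat \<Rightarrow> complex mat \<Rightarrow> bool" where
  "psd d A \<longleftrightarrow> A \<in> carrier_mat d d \<and> (\<forall>v \<in> carrier_vec d. 0 \<le> (A *\<^sub>v v) \<bullet>c v)"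

definition mat_trace :: "'a::comm_monoid_add mat \<Rightarrow> 'a" where
  "mat_trace A = (\<Sum>i<dim_row A. A $$ (i, i))"

definition density_matrix :: "nat \<Rightarrow> complex mat \<Rightarrow> bool" where
  "density_matrix d \<rho> \<longleftrightarrow> psd d \<rho> \<and> mat_trace \<rho> = 1"

definition boolean_test :: "nat \<Rightarrow> complex mat \<Rightarrow> complex mat \<Rightarrow> bool" where
  "boolean_test d E0 E1 \<longleftrightarrow> psd d E0 \<and> psd d E1 \<and> E0 + E1 = 1\<^sub>m d"

text \<open>The trace below is real when \<open>E\<close> is positive semidefinite and \<open>\<rho>\<close> is a density matrix.\<close>

definition outcome_prob :: "complex mat \<Rightarrow> complex mat \<Rightarrow> real" where
  "outcome_prob E \<rho> = Re (mat_trace (E * \<rho>))"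

definition distinguishes :: "real \<Rightarrow> complex mat \<Rightarrow> complex mat \<Rightarrow> complex mat \<Rightarrow> bool" where
  "distinguishes \<epsilon> E1 \<rho> \<sigma> \<longleftrightarrow> \<bar>outcome_prob E1 \<rho> - outcome_prob E1 \<sigma>\<bar> \<ge> \<epsilon>"

definition indistinguishable :: "nat \<Rightarrow> real \<Rightarrow> complex mat \<Rightarrow> complex mat \<Rightarrow> bool" where
  "indistinguishable d \<epsilon> \<rho> \<sigma> \<longleftrightarrow>
     \<not> (\<exists>E0 E1. boolean_test d E0 E1 \<and> distinguishes \<epsilon> E1 \<rho> \<sigma>)"

text \<open>The Kronecker product: \<open>e\<^sub>i \<otimes> e\<^sub>j\<close> is the basis vector with index \<open>i * dim B + j\<close>.\<close>

definition tensor_mat :: "'a::semiring_0 mat \<Rightarrow> 'a mat \<Rightarrow> 'a mat" where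
  "tensor_mat A B = mat (dim_row A * dim_row B) (dim_col A * dim_col B)
     (\<lambda>(i, j). A $$ (i div dim_row B, j div dim_col B) * B $$ (i mod dim_row B, j mod dim_col B))"

text \<open>The projection \<open>|w\<rangle>\<langle>w|\<close>. A bit string \<open>w\<close> labels the basis vector whose index is the number
  with binary digits \<open>w\<close> (least significant digit first), a bijection from
  \<open>bitstrings k\<close> onto \<open>{..<2 ^ k}\<close>.\<close>

definition basis_state :: "bool list \<Rightarrow> complex mat" where
  "basis_state w =
     (let l = horner_sum of_bool 2 w :: nat in
      mat (2 ^ length w) (2 ^ length w) (\<lambda>(i, j). if i = l \<and> j = l then 1 else 0))"

text \<open>The state \<open>\<Sum>z. P(z) \<sigma>(z)\<close> obtained by sampling \<open>z\<close> from the finitely supported \<open>P\<close>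
  and then outputting \<open>\<sigma>(z)\<close>.\<close>

definition mixed_state :: "nat \<Rightarrow> 'a pmf \<Rightarrow> ('a \<Rightarrow> complex mat) \<Rightarrow> complex mat" where
  "mixed_state d P \<sigma> =
     mat d d (\<lambda>(i, j). \<Sum>z\<in>set_pmf P. of_real (pmf P z) * \<sigma> z $$ (i, j))"

section \<open>Extractors against quantum storage\<close>

definition quantum_encoding :: "nat \<Rightarrow> nat \<Rightarrow> (bool list \<Rightarrow> complex mat) \<Rightarrow> bool" where
  "quantum_encoding n b \<rho> \<longleftrightarrow> (\<forall>x \<in> bitstrings n. density_matrix (2 ^ b) (\<rho> x))"

definition extractor_output_state ::
  "nat \<Rightarrow> nat \<Rightarrow> nat \<Rightarrow> (bool list \<Rightarrow> bool list \<Rightarrow> bool list) \<Rightarrow>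
   bool list pmf \<Rightarrow> (bool list \<Rightarrow> complex mat) \<Rightarrow> complex mat" where
  "extractor_output_state t m b E X \<rho> =
     mixed_state (2 ^ (t + m) * 2 ^ b) (pair_pmf X (pmf_of_set (bitstrings t)))
       (\<lambda>(x, y). tensor_mat (basis_state (y @ E x y)) (\<rho> x))"

definition uniform_output_state ::
  "nat \<Rightarrow> nat \<Rightarrow> nat \<Rightarrow> bool list pmf \<Rightarrow> (bool list \<Rightarrow> complex mat) \<Rightarrow> complex mat" where
  "uniform_output_state t m b X \<rho> =
     mixed_state (2 ^ (t + m) * 2 ^ b) (pair_pmf X (pmf_of_set (bitstrings (t + m))))
       (\<lambda>(x, w). tensor_mat (basis_state w) (\<rho> x))"

text \<open>\<open>strong_quantum_extractor n t m k b \<epsilon> E\<close>: the function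
  \<open>E : {0,1}\<^sup>n \<times> {0,1}\<^sup>t \<rightarrow> {0,1}\<^sup>m\<close> is a \<open>(k, b, \<epsilon>)\<close> strong extractor against quantum storage.\<close>

definition strong_quantum_extractor ::
  "nat \<Rightarrow> nat \<Rightarrow> nat \<Rightarrow> real \<Rightarrow> nat \<Rightarrow> real \<Rightarrow> (bool list \<Rightarrow> bool list \<Rightarrow> bool list) \<Rightarrow> bool" where
  "strong_quantum_extractor n t m k b \<epsilon> E \<longleftrightarrow>
     (\<forall>x \<in> bitstrings n. \<forall>y \<in> bitstrings t. E x y \<in> bitstrings m) \<and>
     (\<forall>X \<rho>. set_pmf X \<subseteq> bitstrings n \<and> min_entropy X \<ge> k \<and> quantum_encoding n b \<rho> \<longrightarrow>
        indistinguishable (2 ^ (t + m) * 2 ^ b) \<epsilon>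
          (extractor_output_state t m b E X \<rho>) (uniform_output_state t m b X \<rho>))"

section \<open>Explicit families\<close>

text \<open>Polynomial time is measured on multi-stack machines. A program uses finitely many stacks of
  bits (numbered by naturals) and its control is structured. Every elementary step inspects or
  changes only the top of one stack and costs one time unit. A stack is a tape that is erased when
  its head moves back, and conversely a tape is a pair of stacks, so such machines and
  multi-tape Turing machines simulate each other with constant-factor overhead.\<close>

datatype prog =
    Skip
  | Push nat bool
  | Pop nat
  | Seq prog prog
  | Branch nat prog prog prog
    \<comment> \<open>\<open>Branch r c\<^sub>e c\<^sub>0 c\<^sub>1\<close>: continue according to whether stack \<open>r\<close> is empty, has top 0, or has top 1\<close>
  | Loop nat prog
    \<comment> \<open>repeat while stack \<open>r\<close> is nonempty\<close>

type_synonym stacks = "nat \<Rightarrow> bool list"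

text \<open>\<open>runs c s T s'\<close>: started on stacks \<open>s\<close>, the program \<open>c\<close> halts after \<open>T\<close> steps with stacks \<open>s'\<close>.\<close>

inductive runs :: "prog \<Rightarrow> stacks \<Rightarrow> nat \<Rightarrow> stacks \<Rightarrow> bool" where
  Skip: "runs Skip s 1 s"
| Push: "runs (Push r a) s 1 (s(r := a # s r))"
| Pop: "runs (Pop r) s 1 (s(r := tl (s r)))"
| Seq: "runs c1 s T1 s' \<Longrightarrow> runs c2 s' T2 s'' \<Longrightarrow> runs (Seq c1 c2) s (T1 + T2) s''"
| Branch_empty: "s r = [] \<Longrightarrow> runs ce s T s' \<Longrightarrow> runs (Branch r ce c0 c1) s (Suc T) s'"
| Branch_0: "s r = False # w \<Longrightarrow> runs c0 s T s' \<Longrightarrow> runs (Branch r ce c0 c1) s (Suc T) s'"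
| Branch_1: "s r = True # w \<Longrightarrow> runs c1 s T s' \<Longrightarrow> runs (Branch r ce c0 c1) s (Suc T) s'"
| Loop_done: "s r = [] \<Longrightarrow> runs (Loop r c) s 1 s"
| Loop_step: "s r \<noteq> [] \<Longrightarrow> runs c s T1 s' \<Longrightarrow> runs (Loop r c) s' T2 s'' \<Longrightarrow>
    runs (Loop r c) s (Suc (T1 + T2)) s''"

definition input_stacks :: "bool list \<Rightarrow> bool list \<Rightarrow> stacks" where
  "input_stacks x y = (\<lambda>_. [])(0 := x, 1 := y)"

text \<open>The family \<open>E n : {0,1}\<^sup>n \<times> {0,1}\<^bsup>t n\<^esup> \<rightarrow> {0,1}\<^sup>*\<close> is explicit: one program, on inputs \<open>x\<close> and \<open>y\<close>
  (first bit on top) for any \<open>n\<close>, halts within polynomially many steps in the input length with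
  \<open>E n x y\<close> on stack 2.\<close>

definition explicit_family ::
  "(nat \<Rightarrow> nat) \<Rightarrow> (nat \<Rightarrow> bool list \<Rightarrow> bool list \<Rightarrow> bool list) \<Rightarrow> bool" where
  "explicit_family t E \<longleftrightarrow>
     (\<exists>(c :: prog) (p :: nat poly). \<forall>n. \<forall>x \<in> bitstrings n. \<forall>y \<in> bitstrings (t n).
        \<exists>T s. runs c (input_stacks x y) T s \<and> T \<le> poly p (n + t n) \<and> s 2 = E n x y)"

end

theory Submission
  imports Defs "HOL-Real_Asymp.Real_Asymp"
begin

text \<open>
  A source with min-entropy \<open>n\<close> on \<open>n\<close> bits is uniform, so it suffices to read bits of the source
  itself: for a seed \<open>y\<close> of length \<open>t\<close>, the output consists of the bits of \<open>x\<close> at the positions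
  congruent modulo \<open>2\<^sup>t\<close> to the number with binary digits \<open>y\<close>. The \<open>K = 2\<^sup>t\<close> possible
  outputs are independent uniform blocks of \<open>x\<close>, and \<open>b\<close> qubits cannot hold information about most
  of them.

  Quantitatively, a test with effects \<open>M(y, z)\<close> on the stored state has advantage
  \<open>1/K \<cdot> E\<^sub>x Tr(S(x) \<rho>(x))\<close>, where \<open>S(x) = \<Sum>y. D(y, x\<^sub>y)\<close> and \<open>D(y, z)\<close> is \<open>M(y, z)\<close>
  minus its average over \<open>z\<close>. For \<open>p\<close> a power of two, repeated Cauchy--Schwarz gives
  \<open>Tr(S \<rho>) ^ (2p) \<le> Tr(S ^ (2p))\<close>. Expanding the right-hand side into words in the \<open>D(y, x\<^sub>y)\<close>, every word
  with a letter \<open>y\<close> occurring exactly once has mean zero, and each remaining trace is at most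
  \<open>2 ^ b \<cdot> 2 ^ (2p)\<close>. There are at most \<open>(K choose p) \<cdot> p ^ (2p)\<close> such words, so for \<open>p \<ge> b\<close> the
  squared advantage is at most \<open>24 p / K\<close>. Taking \<open>K\<close> close to \<open>n powr ((1 + \<beta>) / 2)\<close> and
  \<open>p\<close> of order \<open>n powr \<beta>\<close> leaves ample room below the exponent \<open>(1 - \<beta>) / 15\<close>.
\<close>

section \<open>Positive matrices and traces of words\<close>

text \<open>A \<open>d \<times> d\<close> matrix is represented by its entry function, of which only the values at indices
  below \<open>d\<close> matter: the dimension \<open>2 ^ b\<close> varies, so it cannot be a type.\<close>

definition form :: "nat \<Rightarrow> (nat \<Rightarrow> nat \<Rightarrow> complex) \<Rightarrow> (nat \<Rightarrow> complex) \<Rightarrow> (nat \<Rightarrow> complex) \<Rightarrow> complex" where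
  "form d A u v = (\<Sum>i<d. \<Sum>j<d. cnj (u i) * A i j * v j)"

text \<open>On complex numbers \<open>0 \<le>\<close> includes being real; this is where the
  Hermitian symmetry in \<open>positive_form_cnj\<close> comes from.\<close>

definition positive :: "nat \<Rightarrow> (nat \<Rightarrow> nat \<Rightarrow> complex) \<Rightarrow> bool" where
  "positive d A \<longleftrightarrow> (\<forall>v. 0 \<le> form d A v v)"

definition app :: "nat \<Rightarrow> (nat \<Rightarrow> nat \<Rightarrow> complex) \<Rightarrow> (nat \<Rightarrow> complex) \<Rightarrow> nat \<Rightarrow> complex" where
  "app d A v i = (\<Sum>j<d. A i j * v j)"

definition nsq :: "nat \<Rightarrow> (nat \<Rightarrow> complex) \<Rightarrow> real" where
  "nsq d v = (\<Sum>i<d. (cmod (v i))\<^sup>2)"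

definition mul :: "nat \<Rightarrow> (nat \<Rightarrow> nat \<Rightarrow> complex) \<Rightarrow> (nat \<Rightarrow> nat \<Rightarrow> complex) \<Rightarrow> nat \<Rightarrow> nat \<Rightarrow> complex" where
  "mul d A B i j = (\<Sum>k<d. A i k * B k j)"

text \<open>The functional \<open>A \<mapsto> Tr(A \<rho>)\<close>\<close>
definition state :: "nat \<Rightarrow> (nat \<Rightarrow> nat \<Rightarrow> complex) \<Rightarrow> (nat \<Rightarrow> nat \<Rightarrow> complex) \<Rightarrow> complex" where
  "state d \<rho> A = (\<Sum>i<d. \<Sum>j<d. A i j * \<rho> j i)"

definition hermitian :: "nat \<Rightarrow> (nat \<Rightarrow> nat \<Rightarrow> complex) \<Rightarrow> bool" where
  "hermitian d A \<longleftrightarrow> (\<forall>i<d. \<forall>j<d. A j i = cnj (A i j))"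

lemma hermitianD: "hermitian d A \<Longrightarrow> i < d \<Longrightarrow> j < d \<Longrightarrow> cnj (A i j) = A j i"
  unfolding hermitian_def by metis

text \<open>Serves both as the identity matrix and, with one argument, as a standard basis
  vector.\<close>

abbreviation delta :: "nat \<Rightarrow> nat \<Rightarrow> complex" where
  "delta i j \<equiv> of_bool (i = j)"

lemma sum_delta_mult [simp]:
  fixes f :: "nat \<Rightarrow> complex"
  shows "(\<Sum>k<d. delta i k * f k) = (if i < d then f i else 0)"
    and "(\<Sum>k<d. f k * delta i k) = (if i < d then f i else 0)"
    and "(\<Sum>k<d. delta k i * f k) = (if i < d then f i else 0)"
    and "(\<Sum>k<d. f k * delta k i) = (if i < d then f i else 0)"
  by (simp_all add: of_bool_def if_distrib if_distribR sum.delta' sum.delta cong: if_cong)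

lemma form_delta:
  assumes "i < d" "j < d"
  shows "form d A (delta i) (delta j) = A i j"
proof -
  have "form d A (delta i) (delta j) = (\<Sum>k<d. delta i k * (\<Sum>l<d. A k l * delta j l))"
    unfolding form_def sum_distrib_left mult.assoc by (intro sum.cong refl) simp
  also have "\<dots> = A i j" using assms by (simp only: sum_delta_mult) simp
  finally show ?thesis .
qed

section \<open>Sesquilinear forms of positive matrices and norm bounds\<close>

lemma form_add_scale:
  "form d A (\<lambda>i. u i + c * v i) (\<lambda>i. u i + c * v i) =
   form d A u u + c * form d A u v + cnj c * form d A v u + (cnj c * c) * form d A v v"
  unfolding form_def by (simp add: sum.distrib sum_distrib_left algebra_simps)

text \<open>Polarisation: the form at \<open>u + c v\<close> is real for every scalar
  \<open>c\<close>; \<open>c = 1\<close> relates the imaginary parts of the two mixed terms and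
  \<open>c = \<i>\<close> their real parts.\<close>

lemma positive_form_cnj:
  assumes "positive d A"
  shows "form d A v u = cnj (form d A u v)"
proof -
  let ?a = "form d A u v" and ?b = "form d A v u"
  have im: "Im (form d A w w) = 0" for w
    using assms by (simp add: positive_def less_eq_complex_def)
  have "Im (form d A u u + c * ?a + cnj c * ?b + (cnj c * c) * form d A v v) = 0" for c
    unfolding form_add_scale[symmetric] by (rule im)
  from this[of 1] this[of \<i>] show ?thesis
    by (simp add: im complex_eq_iff)
qed

text \<open>The form may be degenerate: minimising over \<open>r\<close> works when
  \<open>Q > 0\<close>, and for \<open>Q = 0\<close> a large \<open>r\<close> forces the mixed term
  to vanish.\<close>

lemma positive_Cauchy_Schwarz:
  assumes "positive d A"
  shows "(cmod (form d A u v))\<^sup>2 \<le> Re (form d A u u) * Re (form d A v v)"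
proof -
  let ?a = "form d A u v"
  define P Q where "P = Re (form d A u u)" and "Q = Re (form d A v v)"
  have nonneg: "0 \<le> Re (form d A w w)" for w
    using assms by (simp add: positive_def less_eq_complex_def)
  have *: "0 \<le> P - 2 * r * (cmod ?a)\<^sup>2 + r\<^sup>2 * (cmod ?a)\<^sup>2 * Q" for r :: real
  proof -
    \<comment> \<open>The phase \<open>cnj ?a\<close> makes both mixed terms equal to the real
      number \<open>- r * (cmod ?a)^2\<close>.\<close>
    let ?c = "- of_real r * cnj ?a"
    have "0 \<le> Re (form d A u u + ?c * ?a + cnj ?c * form d A v u + (cnj ?c * ?c) * form d A v v)"
      unfolding form_add_scale[symmetric] by (rule nonneg)
    also have "form d A v u = cnj ?a" using positive_form_cnj[OF assms] .
    finally show ?thesis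
      unfolding P_def Q_def cmod_power2
      by (simp add: algebra_simps power2_eq_square)
  qed
  show ?thesis
  proof (cases "Q = 0")
    case True
    have "cmod ?a = 0"
    proof (rule ccontr)
      assume "cmod ?a \<noteq> 0"
      \<comment> \<open>This \<open>r\<close> turns the right-hand side of \<open>*\<close> into
        \<open>-1\<close>.\<close>
      with *[of "(P + 1) / (2 * (cmod ?a)\<^sup>2)"] True show False by simp
    qed
    then show ?thesis using True by (simp add: Q_def)
  next
    case False
    then have "Q > 0" using nonneg[of v] by (simp add: Q_def)
    then have "0 \<le> (P - 2 * (1/Q) * (cmod ?a)\<^sup>2 + (1/Q)\<^sup>2 * (cmod ?a)\<^sup>2 * Q) * Q"
      using *[of "1 / Q"] by simp
    also have "\<dots> = P * Q - (cmod ?a)\<^sup>2"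
      using \<open>Q > 0\<close> by (simp add: field_simps power2_eq_square)
    finally show ?thesis by (simp add: P_def Q_def)
  qed
qed

lemma nsq_nonneg: "0 \<le> nsq d v"
  by (simp add: nsq_def sum_nonneg)

lemma form_app: "form d A (app d A v) v = of_real (nsq d (app d A v))"
proof -
  have "form d A (app d A v) v = (\<Sum>i<d. cnj (app d A v i) * app d A v i)"
    unfolding form_def by (simp add: app_def[of d A v] sum_distrib_left mult.assoc)
  also have "\<dots> = of_real (nsq d (app d A v))"
    unfolding nsq_def of_real_sum
    by (intro sum.cong refl) (metis complex_norm_square mult.commute)
  finally show ?thesis .
qed

text \<open>With \<open>w = A v\<close>, \<open>form_app\<close> and Cauchy-Schwarz give
  \<open>|w|^4 \<le> <w, A w> <v, A v> \<le> |w|^2 |v|^2\<close>, so neither square roots nor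
  eigenvalues of \<open>A\<close> enter.\<close>

lemma nsq_app_le:
  assumes "positive d A" "\<And>v. Re (form d A v v) \<le> nsq d v"
  shows "nsq d (app d A v) \<le> nsq d v"
proof (rule ccontr)
  let ?w = "app d A v"
  assume neg: "\<not> ?thesis"
  have "(nsq d ?w)\<^sup>2 = (cmod (form d A ?w v))\<^sup>2"
    by (simp add: form_app)
  also have "\<dots> \<le> Re (form d A ?w ?w) * Re (form d A v v)"
    by (rule positive_Cauchy_Schwarz[OF assms(1)])
  also have "\<dots> \<le> nsq d ?w * nsq d v"
    using assms nsq_nonneg by (intro mult_mono) (auto simp: positive_def less_eq_complex_def)
  also have "\<dots> < nsq d ?w * nsq d ?w"
    using neg nsq_nonneg[of d v] by (intro mult_strict_left_mono) auto
  finally show False by (simp add: power2_eq_square)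
qed

text \<open>The operator inequality between \<rho> and its trace times the identity, without
  diagonalisation: Cauchy-Schwarz on basis vectors bounds each entry by the geometric mean of two
  diagonal entries, and a second Cauchy-Schwarz sums these bounds.\<close>

lemma Re_form_le_trace:
  assumes "positive d \<rho>"
  shows "Re (form d \<rho> v v) \<le> nsq d v * Re (\<Sum>i<d. \<rho> i i)"
proof -
  define r where "r i = Re (\<rho> i i)" for i
  have r: "0 \<le> r i" if "i < d" for i
    using assms form_delta[OF that that, of \<rho>] unfolding r_def positive_def
    by (metis less_eq_complex_def zero_complex.sel(1))
  have ent: "cmod (\<rho> i j) \<le> sqrt (r i) * sqrt (r j)" if "i < d" "j < d" for i j
  proof -
    have "(cmod (\<rho> i j))\<^sup>2 \<le> r i * r j"
      using positive_Cauchy_Schwarz[OF assms, of "delta i" "delta j"] that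
      by (simp add: form_delta r_def)
    then show ?thesis by (metis real_le_rsqrt real_sqrt_mult)
  qed
  have "Re (form d \<rho> v v) \<le> cmod (form d \<rho> v v)" by (rule complex_Re_le_cmod)
  also have "\<dots> \<le> (\<Sum>i<d. \<Sum>j<d. cmod (v i) * (sqrt (r i) * sqrt (r j)) * cmod (v j))"
    unfolding form_def
    by (intro order_trans[OF norm_sum] sum_mono)
      (auto simp: norm_mult r intro!: mult_mono ent)
  also have "\<dots> = (\<Sum>i<d. cmod (v i) * sqrt (r i))\<^sup>2"
    by (simp add: power2_eq_square sum_product algebra_simps)
  also have "\<dots> \<le> (\<Sum>i<d. (cmod (v i))\<^sup>2) * (\<Sum>i<d. (sqrt (r i))\<^sup>2)"
    by (rule Cauchy_Schwarz_ineq_sum)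
  also have "\<dots> = nsq d v * Re (\<Sum>i<d. \<rho> i i)"
    using r by (simp add: nsq_def r_def)
  finally show ?thesis .
qed

section \<open>Density matrices and squares of Hermitian matrices\<close>

lemma state_square:
  assumes "hermitian d T"
  shows "state d \<rho> (mul d T T) = (\<Sum>k<d. form d \<rho> (\<lambda>i. T i k) (\<lambda>i. T i k))"
proof -
  have "state d \<rho> (mul d T T) = (\<Sum>i<d. \<Sum>j<d. \<Sum>k<d. T i k * T k j * \<rho> j i)"
    by (simp add: state_def mul_def sum_distrib_right)
  also have "\<dots> = (\<Sum>j<d. \<Sum>i<d. \<Sum>k<d. T i k * T k j * \<rho> j i)"
    by (rule sum.swap)
  also have "\<dots> = (\<Sum>j<d. \<Sum>i<d. \<Sum>k<d. cnj (T j k) * \<rho> j i * T i k)"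
    by (intro sum.cong refl) (simp add: hermitianD[OF assms] mult_ac)
  also have "\<dots> = (\<Sum>j<d. \<Sum>k<d. \<Sum>i<d. cnj (T j k) * \<rho> j i * T i k)"
    by (intro sum.cong refl sum.swap)
  also have "\<dots> = (\<Sum>k<d. \<Sum>j<d. \<Sum>i<d. cnj (T j k) * \<rho> j i * T i k)"
    by (rule sum.swap)
  finally show ?thesis by (simp add: form_def)
qed

text \<open>A density matrix lies below the identity. This is applied to each column of
  \<open>T\<close>, whose squared column norms add up to the trace of the square.\<close>

lemma Re_state_square_le_trace:
  assumes "positive d \<rho>" "(\<Sum>i<d. \<rho> i i) = 1" "hermitian d T"
  shows "Re (state d \<rho> (mul d T T)) \<le> Re (\<Sum>i<d. mul d T T i i)"
proof -
  have "Re (state d \<rho> (mul d T T)) \<le> (\<Sum>k<d. nsq d (\<lambda>i. T i k))"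
    unfolding state_square[OF assms(3)] Re_sum
    by (intro sum_mono) (use Re_form_le_trace[OF assms(1)] assms(2) in simp)
  also have "\<dots> = Re (\<Sum>k<d. \<Sum>i<d. T k i * T i k)"
    unfolding nsq_def Re_sum
  proof (intro sum.cong refl)
    fix i k assume "i \<in> {..<d}" "k \<in> {..<d}"
    then have "T k i = cnj (T i k)" using hermitianD[OF assms(3)] by simp
    then show "(cmod (T i k))\<^sup>2 = Re (T k i * T i k)"
      unfolding cmod_power2 by (simp add: power2_eq_square)
  qed
  finally show ?thesis by (simp add: mul_def)
qed

text \<open>Nonnegativity of a variance: subtract the mean \<open>r\<close> times the identity from
  \<open>S\<close> and expand the square of the difference.\<close>

lemma square_Re_state_le:
  assumes "positive d \<rho>" "(\<Sum>i<d. \<rho> i i) = 1" "hermitian d S"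
  shows "(Re (state d \<rho> S))\<^sup>2 \<le> Re (state d \<rho> (mul d S S))"
proof -
  define r where "r = Re (state d \<rho> S)"
  define T where "T i j = S i j - of_real r * delta i j" for i j
  have "hermitian d T"
    unfolding hermitian_def by (auto simp: T_def hermitianD[OF assms(3)])
  have tr: "(\<Sum>i<d. \<Sum>j<d. delta i j * \<rho> j i) = 1"
    using assms(2) by simp
  have mulT: "mul d T T i j = mul d S S i j - 2 * of_real r * S i j + (of_real r)\<^sup>2 * delta i j"
    if "i < d" "j < d" for i j
  proof -
    have "mul d T T i j = (\<Sum>k<d. S i k * S k j - of_real r * (S i k * delta k j)
        - of_real r * (delta i k * S k j) + (of_real r)\<^sup>2 * (delta i k * delta k j))"
      unfolding mul_def T_def by (intro sum.cong refl) (simp add: algebra_simps power2_eq_square)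
    also have "\<dots> = mul d S S i j - of_real r * S i j - of_real r * S i j + (of_real r)\<^sup>2 * delta i j"
      using that unfolding sum.distrib sum_subtractf sum_distrib_left[symmetric] sum_delta_mult
      by (simp add: mul_def)
    finally show ?thesis by simp
  qed
  have "0 \<le> Re (state d \<rho> (mul d T T))"
    using assms(1) unfolding state_square[OF \<open>hermitian d T\<close>]
    by (auto simp: positive_def less_eq_complex_def intro!: sum_nonneg)
  also have "state d \<rho> (mul d T T) =
     (\<Sum>i<d. \<Sum>j<d. mul d S S i j * \<rho> j i - 2 * of_real r * (S i j * \<rho> j i)
        + (of_real r)\<^sup>2 * (delta i j * \<rho> j i))"
    unfolding state_def by (intro sum.cong refl) (simp add: mulT algebra_simps)
  also have "\<dots> = state d \<rho> (mul d S S) - 2 * of_real r * state d \<rho> S + (of_real r)\<^sup>2"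
    unfolding sum.distrib sum_subtractf sum_distrib_left[symmetric] tr state_def by simp
  finally have "0 \<le> Re (state d \<rho> (mul d S S)) - 2 * r * r + r\<^sup>2"
    unfolding r_def by (simp add: power2_eq_square)
  then show ?thesis unfolding r_def by (simp add: power2_eq_square)
qed

lemma hermitian_square:
  assumes "hermitian d T"
  shows "hermitian d (mul d T T)"
proof -
  have "mul d T T j i = cnj (mul d T T i j)" if "i < d" "j < d" for i j
    unfolding mul_def cnj_sum using that
    by (intro sum.cong refl) (simp add: hermitianD[OF assms] mult.commute)
  then show ?thesis unfolding hermitian_def by blast
qed

section \<open>Expansion of powers into words\<close>

fun wprod :: "nat \<Rightarrow> (nat \<Rightarrow> nat \<Rightarrow> complex) list \<Rightarrow> nat \<Rightarrow> nat \<Rightarrow> complex" where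
  "wprod d [] = delta"
| "wprod d (M # Ms) = mul d M (wprod d Ms)"

lemma mul_assoc: "mul d (mul d A B) C = mul d A (mul d B C)"
proof (intro ext)
  fix i j
  have "mul d (mul d A B) C i j = (\<Sum>k<d. \<Sum>l<d. A i l * B l k * C k j)"
    by (simp add: mul_def sum_distrib_right)
  also have "\<dots> = (\<Sum>l<d. \<Sum>k<d. A i l * B l k * C k j)" by (rule sum.swap)
  finally show "mul d (mul d A B) C i j = mul d A (mul d B C) i j"
    by (simp add: mul_def sum_distrib_left mult.assoc)
qed

text \<open>\<open>delta\<close> is a left unit only on rows below \<open>d\<close>, whence the
  condition on \<open>i\<close>.\<close>

lemma wprod_append:
  "i < d \<Longrightarrow> wprod d (Ms @ Ns) i j = mul d (wprod d Ms) (wprod d Ns) i j"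
proof (induction Ms arbitrary: i)
  case (Cons M Ms)
  then show ?case by (simp add: mul_assoc) (simp add: mul_def)
qed (simp add: mul_def)

text \<open>Prepending a letter acts on each column separately, and a column of the identity has
  norm 1. Here \<open>C\<close> bounds squared norms, in \<open>norm_wprod_diag\<close>
  norms.\<close>

lemma nsq_wprod:
  assumes "\<And>M v. M \<in> set Ms \<Longrightarrow> nsq d (app d M v) \<le> C * nsq d v" "C \<ge> 0" "j < d"
  shows "nsq d (\<lambda>i. wprod d Ms i j) \<le> C ^ length Ms"
  using assms
proof (induction Ms)
  case Nil
  have "(cmod (delta i j))\<^sup>2 = (if i = j then 1 else 0)" for i by simp
  with Nil show ?case by (simp add: nsq_def sum.delta)
next
  case (Cons M Ms)
  have "(\<lambda>i. wprod d (M # Ms) i j) = app d M (\<lambda>i. wprod d Ms i j)"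
    by (simp add: mul_def app_def fun_eq_iff)
  then have "nsq d (\<lambda>i. wprod d (M # Ms) i j) \<le> C * nsq d (\<lambda>i. wprod d Ms i j)"
    using Cons.prems(1) by simp
  also have "\<dots> \<le> C * C ^ length Ms"
    using Cons by (intro mult_left_mono Cons.IH) auto
  finally show ?case by simp
qed

lemma norm_wprod_diag:
  assumes "\<And>M v. M \<in> set Ms \<Longrightarrow> nsq d (app d M v) \<le> C\<^sup>2 * nsq d v" "C \<ge> 0" "j < d"
  shows "cmod (wprod d Ms j j) \<le> C ^ length Ms"
proof -
  have "(cmod (wprod d Ms j j))\<^sup>2 \<le> nsq d (\<lambda>i. wprod d Ms i j)"
    unfolding nsq_def using assms(3) by (intro member_le_sum) auto
  also have "\<dots> \<le> (C\<^sup>2) ^ length Ms" using assms by (intro nsq_wprod) auto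
  also have "\<dots> = (C ^ length Ms)\<^sup>2" by (simp only: power_mult[symmetric] mult.commute)
  finally show ?thesis using assms(2) power2_le_imp_le zero_le_power by blast
qed

definition words :: "'a set \<Rightarrow> nat \<Rightarrow> 'a list set" where
  "words Y n = {w. set w \<subseteq> Y \<and> length w = n}"

lemma finite_words: "finite Y \<Longrightarrow> finite (words Y n)"
  by (simp add: words_def finite_lists_length_eq)

text \<open>On indices below \<open>d\<close>, the \<open>n\<close>-th power of
  \<open>\<Sum>y\<in>Y. D y\<close>, already expanded so that averages over the source can be taken
  word by word.\<close>

definition wordsum :: "nat \<Rightarrow> 'a set \<Rightarrow> ('a \<Rightarrow> nat \<Rightarrow> nat \<Rightarrow> complex) \<Rightarrow> nat \<Rightarrow> nat \<Rightarrow> nat \<Rightarrow> complex" where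
  "wordsum d Y D n i j = (\<Sum>w\<in>words Y n. wprod d (map D w) i j)"

lemma wordsum_1:
  assumes "j < d"
  shows "wordsum d Y D 1 i j = (\<Sum>y\<in>Y. D y i j)"
proof -
  have "(\<Sum>w\<in>words Y 1. wprod d (map D w) i j) = (\<Sum>y\<in>Y. wprod d (map D [y]) i j)"
    by (rule sum.reindex_bij_witness[of _ "\<lambda>y. [y]" hd])
      (auto simp: words_def length_Suc_conv)
  then show ?thesis using assms by (simp add: wordsum_def mul_def)
qed

text \<open>Concatenation is a bijection from pairs of words of lengths \<open>m\<close> and
  \<open>n\<close> to words of length \<open>m + n\<close>.\<close>

lemma wordsum_add:
  assumes "i < d"
  shows "mul d (wordsum d Y D m) (wordsum d Y D n) i j = wordsum d Y D (m + n) i j"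
proof -
  have "mul d (wordsum d Y D m) (wordsum d Y D n) i j =
     (\<Sum>k<d. \<Sum>(u, v)\<in>words Y m \<times> words Y n. wprod d (map D u) i k * wprod d (map D v) k j)"
    by (simp add: mul_def wordsum_def sum_product sum.cartesian_product)
  also have "\<dots> = (\<Sum>(u, v)\<in>words Y m \<times> words Y n. \<Sum>k<d. wprod d (map D u) i k * wprod d (map D v) k j)"
    by (subst sum.swap) (simp add: case_prod_beta)
  also have "\<dots> = (\<Sum>(u, v)\<in>words Y m \<times> words Y n. wprod d (map D (u @ v)) i j)"
    using assms by (simp add: wprod_append mul_def)
  also have "\<dots> = wordsum d Y D (m + n) i j"
    unfolding wordsum_def
    by (rule sum.reindex_bij_witness[of _ "\<lambda>w. (take m w, drop m w)" "\<lambda>(u, v). u @ v"])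
      (auto simp: words_def dest: in_set_takeD in_set_dropD)
  finally show ?thesis .
qed

text \<open>Each use of \<open>square_Re_state_le\<close> doubles the word length and halves the
  outer exponent, so the induction varies \<open>n\<close>; the last squaring passes to the trace,
  where \<rho> disappears.\<close>

lemma state_power_le_trace:
  assumes "positive d \<rho>" "(\<Sum>i<d. \<rho> i i) = 1" "hermitian d (wordsum d Y D n)"
  shows "Re (state d \<rho> (wordsum d Y D n)) ^ 2 ^ Suc q \<le> Re (\<Sum>i<d. wordsum d Y D (n * 2 ^ Suc q) i i)"
  using assms(3)
proof (induction q arbitrary: n)
  case 0
  have "(Re (state d \<rho> (wordsum d Y D n)))\<^sup>2 \<le> Re (\<Sum>i<d. mul d (wordsum d Y D n) (wordsum d Y D n) i i)"
    using square_Re_state_le[OF assms(1,2) 0] Re_state_square_le_trace[OF assms(1,2) 0] by simp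
  then show ?case by (simp add: wordsum_add mult_2_right)
next
  case (Suc q)
  let ?S = "wordsum d Y D n" and ?S2 = "wordsum d Y D (n + n)"
  have eq: "mul d ?S ?S i j = ?S2 i j" if "i < d" for i j
    using that by (rule wordsum_add)
  have herm: "hermitian d ?S2"
    unfolding hermitian_def by (simp add: eq[symmetric] hermitianD[OF hermitian_square[OF Suc.prems]])
  have "Re (state d \<rho> ?S) ^ 2 ^ Suc (Suc q) = ((Re (state d \<rho> ?S))\<^sup>2) ^ 2 ^ Suc q"
    by (simp add: power_mult[symmetric])
  also have "\<dots> \<le> Re (state d \<rho> ?S2) ^ 2 ^ Suc q"
    using square_Re_state_le[OF assms(1,2) Suc.prems] by (intro power_mono) (simp_all add: state_def eq)
  also have "\<dots> \<le> Re (\<Sum>i<d. wordsum d Y D ((n + n) * 2 ^ Suc q) i i)"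
    by (rule Suc.IH[OF herm])
  finally show ?case by (simp add: algebra_simps)
qed

section \<open>Moments of sums over independent blocks\<close>

text \<open>Jensen with equal weights; evenness makes the power convex on the whole real
  line.\<close>

lemma convex_power_mean_le:
  fixes f :: "'a \<Rightarrow> real"
  assumes "finite S" "S \<noteq> {}" "even n"
  shows "((\<Sum>x\<in>S. f x) / card S) ^ n \<le> (\<Sum>x\<in>S. f x ^ n) / card S"
proof -
  have "(\<Sum>x\<in>S. (1 / card S) *\<^sub>R f x) ^ n \<le> (\<Sum>x\<in>S. (1 / card S) * f x ^ n)"
    using assms by (intro convex_on_sum[OF _ _ convex_power_even]) auto
  then show ?thesis by (simp add: sum_divide_distrib)
qed

text \<open>Independence and uniformity of the blocks in resampling form: \<open>upd y z\<close>
  overwrites block \<open>y\<close>, keeps the other blocks, and is undone by writing the old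
  content back.\<close>

locale independent_blocks =
  fixes \<Omega> :: "'x set" and Y :: "'y set" and Z :: "'z set"
    and block :: "'x \<Rightarrow> 'y \<Rightarrow> 'z" and upd :: "'y \<Rightarrow> 'z \<Rightarrow> 'x \<Rightarrow> 'x"
  assumes finite_space: "finite \<Omega>" "finite Y" "finite Z" and nonempty: "\<Omega> \<noteq> {}" "Z \<noteq> {}"
    and block: "x \<in> \<Omega> \<Longrightarrow> y \<in> Y \<Longrightarrow> block x y \<in> Z"
    and upd: "x \<in> \<Omega> \<Longrightarrow> y \<in> Y \<Longrightarrow> z \<in> Z \<Longrightarrow> upd y z x \<in> \<Omega>"
    and block_upd: "x \<in> \<Omega> \<Longrightarrow> y \<in> Y \<Longrightarrow> y' \<in> Y \<Longrightarrow> z \<in> Z \<Longrightarrow>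
      block (upd y z x) y' = (if y' = y then z else block x y')"
    and upd_upd: "x \<in> \<Omega> \<Longrightarrow> y \<in> Y \<Longrightarrow> z \<in> Z \<Longrightarrow> upd y (block x y) (upd y z x) = x"
begin

text \<open>The map \<open>(x, z) \<mapsto> (upd y z x, block x y)\<close>, which exchanges a block
  with a fresh value, is an involution of \<open>\<Omega> \<times> Z\<close>.\<close>

lemma sum_resample:
  fixes F :: "'x \<Rightarrow> complex"
  assumes "y \<in> Y"
  shows "(\<Sum>x\<in>\<Omega>. \<Sum>z\<in>Z. F (upd y z x)) = of_nat (card Z) * (\<Sum>x\<in>\<Omega>. F x)"
proof -
  have "(\<Sum>(x, z)\<in>\<Omega> \<times> Z. F (upd y z x)) = (\<Sum>(x, z)\<in>\<Omega> \<times> Z. F x)"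
    by (rule sum.reindex_bij_witness[of _ "\<lambda>(x, z). (upd y z x, block x y)" "\<lambda>(x, z). (upd y z x, block x y)"])
      (auto simp: assms block upd block_upd upd_upd)
  then show ?thesis
    by (simp add: sum.cartesian_product[symmetric] sum_distrib_left)
qed

text \<open>Resampling block \<open>y\<close> changes only the factor of the isolated letter, and
  that factor sums to zero over \<open>z\<close> because \<open>D y\<close> is centred.\<close>

lemma sum_wprod_eq_0:
  assumes centred: "\<And>y i j. y \<in> Y \<Longrightarrow> i < d \<Longrightarrow> j < d \<Longrightarrow> (\<Sum>z\<in>Z. D y z i j) = 0"
    and w: "set w \<subseteq> Y" "count_list w y = 1" and "i < d"
  shows "(\<Sum>x\<in>\<Omega>. wprod d (map (\<lambda>y. D y (block x y)) w) i j) = 0"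
proof -
  have "y \<in> set w" using w(2) by (metis count_notin zero_neq_one)
  then obtain u v where uv: "w = u @ y # v" by (auto simp: in_set_conv_decomp)
  with w(2) have notin: "y \<notin> set u" "y \<notin> set v"
    by (simp_all add: count_list_0_iff)
  have Y: "y \<in> Y" "set u \<subseteq> Y" "set v \<subseteq> Y" using w(1) uv by auto
  define P where "P = (\<lambda>x u. wprod d (map (\<lambda>y. D y (block x y)) u))"
  have exp: "P x w i j = (\<Sum>k<d. \<Sum>l<d. P x u i k * D y (block x y) k l * P x v l j)" for x
    using \<open>i < d\<close> unfolding uv P_def
    by (simp add: wprod_append) (simp add: mul_def sum_distrib_left mult.assoc)
  have inv: "P (upd y z x) u = P x u" if "x \<in> \<Omega>" "z \<in> Z" "y \<notin> set u" "set u \<subseteq> Y" for x z u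
  proof -
    have "map (\<lambda>y'. D y' (block (upd y z x) y')) u = map (\<lambda>y'. D y' (block x y')) u"
      using that Y by (auto simp: block_upd)
    then show ?thesis by (simp only: P_def)
  qed
  have zero: "(\<Sum>z\<in>Z. P (upd y z x) w i j) = 0" if x: "x \<in> \<Omega>" for x
  proof -
    have "(\<Sum>z\<in>Z. P (upd y z x) w i j) = (\<Sum>z\<in>Z. \<Sum>k<d. \<Sum>l<d. P x u i k * D y z k l * P x v l j)"
      using x Y notin by (intro sum.cong refl) (simp add: exp inv block_upd)
    also have "\<dots> = (\<Sum>k<d. \<Sum>z\<in>Z. \<Sum>l<d. P x u i k * D y z k l * P x v l j)" by (rule sum.swap)
    also have "\<dots> = (\<Sum>k<d. \<Sum>l<d. \<Sum>z\<in>Z. P x u i k * D y z k l * P x v l j)"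
      by (intro sum.cong refl sum.swap)
    also have "\<dots> = (\<Sum>k<d. \<Sum>l<d. P x u i k * (\<Sum>z\<in>Z. D y z k l) * P x v l j)"
      by (simp add: sum_distrib_left sum_distrib_right)
    also have "\<dots> = 0" using centred[OF Y(1)] by simp
    finally show ?thesis .
  qed
  have "of_nat (card Z) * (\<Sum>x\<in>\<Omega>. P x w i j) = 0"
    unfolding sum_resample[OF Y(1), symmetric] by (simp add: zero)
  then show ?thesis using finite_space nonempty by (simp add: P_def)
qed

end

text \<open>A word of length \<open>2p\<close> without isolated letters has at most \<open>p\<close> distinct letters.\<close>
lemma card_words_no_single_letter:
  assumes "finite Y" "p \<le> card Y"
  shows "card {w \<in> words Y (2 * p). \<forall>y. count_list w y \<noteq> 1} \<le> (card Y choose p) * p ^ (2 * p)"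
proof -
  let ?R = "{R. R \<subseteq> Y \<and> card R = p}"
  have finR: "finite ?R" using assms by simp
  have finU: "finite (\<Union>R\<in>?R. words R (2 * p))"
  proof (intro finite_UN_I finR finite_words)
    show "finite R" if "R \<in> ?R" for R using that assms(1) finite_subset by blast
  qed
  have "{w \<in> words Y (2 * p). \<forall>y. count_list w y \<noteq> 1} \<subseteq> (\<Union>R\<in>?R. words R (2 * p))"
  proof
    fix w assume "w \<in> {w \<in> words Y (2 * p). \<forall>y. count_list w y \<noteq> 1}"
    then have w: "set w \<subseteq> Y" "length w = 2 * p" "\<And>y. count_list w y \<noteq> 1"
      by (auto simp: words_def)
    have "2 * card (set w) = (\<Sum>y\<in>set w. 2)" by simp
    also have "\<dots> \<le> (\<Sum>y\<in>set w. count_list w y)"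
    proof (rule sum_mono)
      fix y assume "y \<in> set w"
      then have "count_list w y \<noteq> 0" by (simp add: count_list_0_iff)
      with w(3)[of y] show "2 \<le> count_list w y" by linarith
    qed
    also have "\<dots> = length w" by (rule sum_count_set) auto
    finally have "card (set w) \<le> p" using w(2) by simp
    \<comment> \<open>Enlarging the letter set to exactly \<open>p\<close> elements, possible as
      \<open>p \<le> card Y\<close>, lets a single binomial coefficient count the choices.\<close>
    then obtain R where "set w \<subseteq> R" "R \<subseteq> Y" "card R = p"
      using exists_subset_between[of "set w" p Y] assms w(1) by auto
    then show "w \<in> (\<Union>R\<in>?R. words R (2 * p))" using w(2) by (auto simp: words_def)
  qed
  then have "card {w \<in> words Y (2 * p). \<forall>y. count_list w y \<noteq> 1} \<le> card (\<Union>R\<in>?R. words R (2 * p))"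
    by (rule card_mono[OF finU])
  also have "\<dots> \<le> (\<Sum>R\<in>?R. card (words R (2 * p)))"
    by (rule card_UN_le[OF finR])
  also have "\<dots> = (\<Sum>R\<in>?R. p ^ (2 * p))"
  proof (intro sum.cong refl)
    fix R assume R: "R \<in> ?R"
    then have "finite R" using assms(1) finite_subset by blast
    then show "card (words R (2 * p)) = p ^ (2 * p)"
      using R card_lists_length_eq[of R "2 * p"] by (simp add: words_def)
  qed
  also have "\<dots> = (card Y choose p) * p ^ (2 * p)"
    by (simp add: n_subsets[OF assms(1)])
  finally show ?thesis .
qed

text \<open>\<open>p ^ p / p!\<close> is one term of the series of \<open>exp p\<close>, and
  \<open>exp 1 \<le> 3\<close>.\<close>

lemma power_self_le_fact: "real p ^ p \<le> 3 ^ p * fact p"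
proof -
  have "real p ^ p / fact p = (\<Sum>n\<in>{p}. inverse (fact n) *\<^sub>R real p ^ n)" by (simp add: field_simps)
  also have "\<dots> \<le> exp (real p)"
    unfolding exp_def by (intro sum_le_suminf summable_exp_generic) auto
  also have "\<dots> = exp 1 ^ p" by (simp add: exp_of_nat_mult[symmetric])
  also have "\<dots> \<le> 3 ^ p" by (intro power_mono exp_le) auto
  finally show ?thesis by (simp add: field_simps)
qed

text \<open>The factor \<open>2 ^ p\<close> stands for the dimension and \<open>2 ^ (2 * p)\<close>
  for the norms of the letters. The binomial is at most \<open>K ^ p / p!\<close>, and the factorial
  cancels one of the two factors \<open>p ^ p\<close> at a cost of \<open>3 ^ p\<close>; hence
  \<open>24 = 3 * 2 * 4\<close>.\<close>

lemma moment_constant_le: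
  assumes "p \<le> K"
  shows "real (K choose p) * real p ^ (2 * p) * 2 ^ p * 2 ^ (2 * p) \<le> (24 * real K * real p) ^ p"
proof -
  have "real (K choose p) * real p ^ (2 * p) * fact p \<le> real K ^ p * real p ^ (2 * p)"
  proof -
    have "real (K choose p) * fact p \<le> real K ^ p"
      using binomial_fact_pow[of K p] by (metis of_nat_fact of_nat_le_iff of_nat_mult of_nat_power)
    then have "(real (K choose p) * fact p) * real p ^ (2 * p) \<le> real K ^ p * real p ^ (2 * p)"
      by (rule mult_right_mono) simp
    then show ?thesis by (simp add: mult_ac)
  qed
  also have "\<dots> = real K ^ p * real p ^ p * real p ^ p" by (simp add: mult_2 power_add)
  also have "\<dots> \<le> real K ^ p * real p ^ p * (3 ^ p * fact p)"
    by (intro mult_left_mono power_self_le_fact) simp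
  finally have "real (K choose p) * real p ^ (2 * p) \<le> real K ^ p * real p ^ p * 3 ^ p"
    by (simp add: mult.assoc[symmetric])
  then have "real (K choose p) * real p ^ (2 * p) * (2 ^ p * 2 ^ (2 * p)) \<le> real K ^ p * real p ^ p * 3 ^ p * (2 ^ p * 2 ^ (2 * p))"
    by (rule mult_right_mono) simp
  also have "\<dots> = (real K * real p * 3 * (2 * 2\<^sup>2)) ^ p"
    by (simp only: power_mult_distrib power_mult)
  also have "real K * real p * 3 * (2 * 2\<^sup>2) = 24 * real K * real p" by simp
  finally show ?thesis by (simp add: mult_ac)
qed

context independent_blocks
begin

text \<open>Words with an isolated letter average to zero. Letters have operator norm at most 2, so
  every other word contributes at most \<open>2 ^ (2 * p)\<close> on each of the \<open>d\<close>
  diagonal entries.\<close>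

lemma mean_trace_wordsum_le:
  assumes centred: "\<And>y i j. y \<in> Y \<Longrightarrow> i < d \<Longrightarrow> j < d \<Longrightarrow> (\<Sum>z\<in>Z. D y z i j) = 0"
    and bounded: "\<And>y z v. y \<in> Y \<Longrightarrow> z \<in> Z \<Longrightarrow> nsq d (app d (D y z) v) \<le> 2\<^sup>2 * nsq d v"
    and "p \<le> card Y"
  shows "(\<Sum>x\<in>\<Omega>. Re (\<Sum>i<d. wordsum d Y (\<lambda>y. D y (block x y)) (2 * p) i i)) / card \<Omega>
    \<le> real (card Y choose p) * real p ^ (2 * p) * d * 2 ^ (2 * p)"
proof -
  let ?W = "\<lambda>x w i. wprod d (map (\<lambda>y. D y (block x y)) w) i i"
  let ?S = "{w \<in> words Y (2 * p). \<forall>y. count_list w y \<noteq> 1}"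
  have fin: "finite (words Y (2 * p))" "finite ?S" using finite_space by (simp_all add: finite_words)
  have "(\<Sum>x\<in>\<Omega>. \<Sum>i<d. wordsum d Y (\<lambda>y. D y (block x y)) (2 * p) i i) =
      (\<Sum>x\<in>\<Omega>. \<Sum>i<d. \<Sum>w\<in>words Y (2 * p). ?W x w i)"
    by (simp add: wordsum_def)
  also have "\<dots> = (\<Sum>x\<in>\<Omega>. \<Sum>w\<in>words Y (2 * p). \<Sum>i<d. ?W x w i)"
    by (intro sum.cong refl sum.swap)
  also have "\<dots> = (\<Sum>w\<in>words Y (2 * p). \<Sum>x\<in>\<Omega>. \<Sum>i<d. ?W x w i)" by (rule sum.swap)
  also have "\<dots> = (\<Sum>w\<in>words Y (2 * p). \<Sum>i<d. \<Sum>x\<in>\<Omega>. ?W x w i)"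
    by (intro sum.cong refl sum.swap)
  also have "\<dots> = (\<Sum>w\<in>?S. \<Sum>i<d. \<Sum>x\<in>\<Omega>. ?W x w i)"
  proof (intro sum.mono_neutral_right ballI)
    fix w assume w: "w \<in> words Y (2 * p) - ?S"
    then obtain y where "count_list w y = 1" by auto
    then have "(\<Sum>x\<in>\<Omega>. ?W x w i) = 0" if "i < d" for i
      using w that sum_wprod_eq_0[OF centred] by (auto simp: words_def)
    then show "(\<Sum>i<d. \<Sum>x\<in>\<Omega>. ?W x w i) = 0" by simp
  qed (use fin in auto)
  finally have eq: "(\<Sum>x\<in>\<Omega>. \<Sum>i<d. wordsum d Y (\<lambda>y. D y (block x y)) (2 * p) i i) =
     (\<Sum>w\<in>?S. \<Sum>i<d. \<Sum>x\<in>\<Omega>. ?W x w i)" .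
  have bnd: "cmod (?W x w i) \<le> 2 ^ (2 * p)" if "x \<in> \<Omega>" "w \<in> ?S" "i < d" for x w i
  proof -
    have "cmod (?W x w i) \<le> 2 ^ length (map (\<lambda>y. D y (block x y)) w)"
    proof (rule norm_wprod_diag)
      fix M v assume "M \<in> set (map (\<lambda>y. D y (block x y)) w)"
      then show "nsq d (app d M v) \<le> 2\<^sup>2 * nsq d v"
        using bounded block that by (auto simp: words_def)
    qed (use that in auto)
    then show ?thesis using that by (simp add: words_def)
  qed
  have "(\<Sum>x\<in>\<Omega>. Re (\<Sum>i<d. wordsum d Y (\<lambda>y. D y (block x y)) (2 * p) i i)) =
     Re (\<Sum>w\<in>?S. \<Sum>i<d. \<Sum>x\<in>\<Omega>. ?W x w i)"
    unfolding eq[symmetric] Re_sum ..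
  also have "\<dots> \<le> cmod (\<Sum>w\<in>?S. \<Sum>i<d. \<Sum>x\<in>\<Omega>. ?W x w i)" by (rule complex_Re_le_cmod)
  also have "\<dots> \<le> (\<Sum>w\<in>?S. \<Sum>i<d. \<Sum>x\<in>\<Omega>. 2 ^ (2 * p))"
    by (intro order_trans[OF norm_sum] sum_mono bnd) auto
  also have "\<dots> = real (card ?S) * (d * (card \<Omega> * 2 ^ (2 * p)))" by simp
  also have "\<dots> \<le> real ((card Y choose p) * p ^ (2 * p)) * (d * (card \<Omega> * 2 ^ (2 * p)))"
    using card_words_no_single_letter[OF finite_space(2) assms(3)]
    by (intro mult_right_mono) (simp_all del: of_nat_mult of_nat_power)
  finally show ?thesis
    using finite_space nonempty by (simp add: divide_le_eq card_gt_0_iff mult_ac)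
qed

text \<open>Jensen moves the power \<open>2 * p\<close>, with \<open>p = 2 ^ q\<close>, inside the
  mean over the source; there \<open>state_power_le_trace\<close> removes the states and the moment
  bound applies. A \<open>p\<close>-th root leaves a bound on the square.\<close>

lemma mean_state_le:
  assumes centred: "\<And>y i j. y \<in> Y \<Longrightarrow> i < d \<Longrightarrow> j < d \<Longrightarrow> (\<Sum>z\<in>Z. D y z i j) = 0"
    and bounded: "\<And>y z v. y \<in> Y \<Longrightarrow> z \<in> Z \<Longrightarrow> nsq d (app d (D y z) v) \<le> 2\<^sup>2 * nsq d v"
    and herm: "\<And>y z. y \<in> Y \<Longrightarrow> z \<in> Z \<Longrightarrow> hermitian d (D y z)"
    and states: "\<And>x. x \<in> \<Omega> \<Longrightarrow> positive d (\<rho> x)" "\<And>x. x \<in> \<Omega> \<Longrightarrow> (\<Sum>i<d. \<rho> x i i) = 1"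
    and "2 ^ q \<le> card Y" "d \<le> 2 ^ 2 ^ q"
  shows "((\<Sum>x\<in>\<Omega>. Re (state d (\<rho> x) (\<lambda>i j. \<Sum>y\<in>Y. D y (block x y) i j))) / card \<Omega> / card Y)\<^sup>2
    \<le> 24 * 2 ^ q / card Y"
proof -
  define p :: nat where "p = 2 ^ q"
  define K where "K = card Y"
  have p: "p > 0" "p \<le> K" "K > 0" using assms(6) unfolding p_def K_def by (simp, simp, metis gr0I le_zero_eq power_not_zero zero_neq_numeral)
  let ?S = "\<lambda>x i j. \<Sum>y\<in>Y. D y (block x y) i j"
  let ?ws = "\<lambda>x. wordsum d Y (\<lambda>y. D y (block x y))"
  define a where "a x = Re (state d (\<rho> x) (?S x))" for x
  have le: "a x ^ (2 * p) \<le> Re (\<Sum>i<d. ?ws x (2 * p) i i)" if x: "x \<in> \<Omega>" for x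
  proof -
    have "hermitian d (?ws x 1)"
    proof -
      have "?ws x 1 j i = cnj (?ws x 1 i j)" if "i < d" "j < d" for i j
        unfolding wordsum_1[OF that(1)] wordsum_1[OF that(2)] cnj_sum
        by (intro sum.cong refl) (use hermitianD[OF herm] block x that in simp)
      then show ?thesis unfolding hermitian_def by blast
    qed
    then have "Re (state d (\<rho> x) (?ws x 1)) ^ 2 ^ Suc q \<le> Re (\<Sum>i<d. ?ws x (1 * 2 ^ Suc q) i i)"
      using states x by (intro state_power_le_trace) auto
    moreover have "state d (\<rho> x) (?ws x 1) = state d (\<rho> x) (?S x)"
      unfolding state_def by (intro sum.cong refl) (simp add: wordsum_1[simplified])
    ultimately show ?thesis by (simp add: a_def p_def)
  qed
  let ?A = "(\<Sum>x\<in>\<Omega>. a x) / card \<Omega>"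
  have "?A ^ (2 * p) \<le> (\<Sum>x\<in>\<Omega>. a x ^ (2 * p)) / card \<Omega>"
    using finite_space nonempty by (intro convex_power_mean_le) auto
  also have "\<dots> \<le> (\<Sum>x\<in>\<Omega>. Re (\<Sum>i<d. ?ws x (2 * p) i i)) / card \<Omega>"
    by (intro divide_right_mono sum_mono le) auto
  also have "\<dots> \<le> real (K choose p) * real p ^ (2 * p) * d * 2 ^ (2 * p)"
    using mean_trace_wordsum_le[OF centred bounded, where p = p] p by (simp add: K_def)
  \<comment> \<open>The storage enters only through its dimension: \<open>d \<le> 2 ^ p\<close>
    becomes a constant factor after the \<open>p\<close>-th root.\<close>
  also have "\<dots> \<le> real (K choose p) * real p ^ (2 * p) * 2 ^ p * 2 ^ (2 * p)"
  proof -
    have "real d \<le> 2 ^ p" using assms(7) unfolding p_def by (metis of_nat_le_iff of_nat_numeral of_nat_power)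
    then show ?thesis by (intro mult_right_mono mult_left_mono) auto
  qed
  also have "\<dots> \<le> (24 * real K * real p) ^ p" using p by (intro moment_constant_le)
  finally have "(?A\<^sup>2) ^ p \<le> (24 * real K * real p) ^ p" by (simp add: power_mult)
  then have "?A\<^sup>2 \<le> 24 * real K * real p"
    using p by (subst (asm) power_mono_iff) auto
  \<comment> \<open>Division by the square of \<open>K\<close> accounts for averaging over the
    seeds.\<close>
  then have "?A\<^sup>2 / (real K)\<^sup>2 \<le> 24 * real K * real p / (real K)\<^sup>2"
    by (intro divide_right_mono) auto
  also have "\<dots> = 24 * 2 ^ q / K" using p by (simp add: p_def power2_eq_square)
  finally show ?thesis by (simp add: power_divide power_mult_distrib a_def K_def)
qed

end

section \<open>Bit selection on stack machines\<close>

fun halve :: "bool \<Rightarrow> 'a list \<Rightarrow> 'a list" where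
  "halve b (x0 # x1 # w) = (if b then x1 else x0) # halve b w"
| "halve b _ = []"

lemma runs_Pop': "s' = s(r := tl (s r)) \<Longrightarrow> runs (Pop r) s 1 s'"
  by (metis runs.Pop)

lemma runs_Push': "s' = s(r := a # s r) \<Longrightarrow> runs (Push r a) s 1 s'"
  by (metis runs.Push)

lemma runs_Branch_Cons:
  assumes "s r = a # w" "runs (if a then c1 else c0) s T s'"
  shows "runs (Branch r ce c0 c1) s (Suc T) s'"
  using assms by (cases a) (auto intro: runs.Branch_0 runs.Branch_1)

text \<open>The transfer reverses the order, so the programs below pair reversals to restore
  it.\<close>

definition move :: "nat \<Rightarrow> nat \<Rightarrow> prog" where
  "move r q = Loop r (Branch r Skip (Seq (Push q False) (Pop r)) (Seq (Push q True) (Pop r)))"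

text \<open>Each bit costs four steps (loop test, branch, push, pop), and the final loop test one
  more.\<close>

lemma runs_move:
  assumes "r \<noteq> q"
  shows "runs (move r q) s (4 * length (s r) + 1) (s(r := [], q := rev (s r) @ s q))"
proof (induction "s r" arbitrary: s)
  case Nil
  then have "s(r := [], q := rev (s r) @ s q) = s"
    using assms by (auto simp: fun_eq_iff)
  with Nil show ?case
    by (simp only: move_def) (simp add: runs.Loop_done[simplified])
next
  case (Cons a w)
  define s1 where "s1 = s(r := w, q := a # s q)"
  have "runs (Seq (Push q a) (Pop r)) s (1 + 1) s1"
    by (rule runs.Seq[OF runs.Push runs_Pop'])
      (use Cons(2)[symmetric] assms in \<open>auto simp: s1_def fun_eq_iff\<close>)
  then have s1: "runs (Branch r Skip (Seq (Push q False) (Pop r)) (Seq (Push q True) (Pop r))) s (Suc (1 + 1)) s1"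
    using Cons(2)[symmetric] by (intro runs_Branch_Cons[of _ _ a w]) (cases a; simp)+
  have "runs (move r q) s1 (4 * length w + 1) (s1(r := [], q := rev w @ s1 q))"
    using Cons(1)[of s1] assms by (simp add: s1_def)
  then have "runs (move r q) s (Suc (Suc (1 + 1) + (4 * length w + 1))) (s1(r := [], q := rev w @ s1 q))"
    unfolding move_def
    by (intro runs.Loop_step[OF _ s1]) (use Cons(2)[symmetric] in auto)
  moreover have "s1(r := [], q := rev w @ s1 q) = s(r := [], q := rev (s r) @ s q)"
    using Cons(2)[symmetric] assms by (auto simp: s1_def fun_eq_iff)
  moreover have "Suc (Suc (1 + 1) + (4 * length w + 1)) = 4 * length (s r) + 1"
    using Cons(2)[symmetric] by simp
  ultimately show ?case by metis
qed

text \<open>Stack 3 receives the kept bits, in reverse order; an unpaired last bit is dropped.\<close>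

definition halve_step :: "bool \<Rightarrow> prog" where
  "halve_step b =
     (if b then Seq (Pop 0) (Branch 0 Skip (Seq (Pop 0) (Push 3 False)) (Seq (Pop 0) (Push 3 True)))
      else Branch 0 Skip
        (Seq (Pop 0) (Branch 0 Skip (Seq (Pop 0) (Push 3 False)) (Seq (Pop 0) (Push 3 False))))
        (Seq (Pop 0) (Branch 0 Skip (Seq (Pop 0) (Push 3 True)) (Seq (Pop 0) (Push 3 True)))))"

definition halve_prog :: "bool \<Rightarrow> prog" where
  "halve_prog b = Loop 0 (halve_step b)"

text \<open>A pass over two bits costs at most six steps, loop test included. The budget of six per
  bit also covers a last pass over a single bit.\<close>

lemma runs_halve_prog:
  "s 0 = w \<Longrightarrow> \<exists>T. runs (halve_prog b) s T (s(0 := [], 3 := rev (halve b w) @ s 3)) \<and> T \<le> 6 * length w + 1"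
proof (induction b w arbitrary: s rule: halve.induct)
  case (1 b x0 x1 w)
  define s1 where "s1 = s(0 := w, 3 := (if b then x1 else x0) # s 3)"
  obtain T where T: "runs (halve_prog b) s1 T (s1(0 := [], 3 := rev (halve b w) @ s1 3))" "T \<le> 6 * length w + 1"
    using "1.IH"[of s1] unfolding s1_def by (metis fun_upd_other fun_upd_same zero_neq_numeral)
  define sa where "sa = s(0 := x1 # w)"
  have sa: "runs (Pop 0) s 1 sa"
    using 1(2) by (intro runs_Pop') (simp add: sa_def)
  have fin: "runs (Seq (Pop 0) (Push 3 (if b then x1 else x0))) sa (1 + 1) s1"
    by (rule runs.Seq[OF runs.Pop runs_Push']) (auto simp: sa_def s1_def fun_eq_iff)
  have "\<exists>T. runs (halve_step b) s T s1 \<and> T \<le> 5"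
  proof (cases b)
    case True
    have "runs (Branch 0 Skip (Seq (Pop 0) (Push 3 False)) (Seq (Pop 0) (Push 3 True))) sa (Suc (1 + 1)) s1"
      using fin True by (intro runs_Branch_Cons[of _ _ x1 w]) (auto simp: sa_def)
    then have "runs (Seq (Pop 0) (Branch 0 Skip (Seq (Pop 0) (Push 3 False)) (Seq (Pop 0) (Push 3 True)))) s (1 + Suc (1 + 1)) s1"
      by (rule runs.Seq[OF sa])
    then show ?thesis using True by (intro exI[of _ "1 + Suc (1 + 1)"]) (simp add: halve_step_def)
  next
    case False
    have "runs (Branch 0 Skip (Seq (Pop 0) (Push 3 x0)) (Seq (Pop 0) (Push 3 x0))) sa (Suc (1 + 1)) s1"
      using fin False by (intro runs_Branch_Cons[of _ _ x1 w]) (auto simp: sa_def)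
    then have "runs (Seq (Pop 0) (Branch 0 Skip (Seq (Pop 0) (Push 3 x0)) (Seq (Pop 0) (Push 3 x0)))) s (1 + Suc (1 + 1)) s1"
      by (rule runs.Seq[OF sa])
    then have "runs (Branch 0 Skip
        (Seq (Pop 0) (Branch 0 Skip (Seq (Pop 0) (Push 3 False)) (Seq (Pop 0) (Push 3 False))))
        (Seq (Pop 0) (Branch 0 Skip (Seq (Pop 0) (Push 3 True)) (Seq (Pop 0) (Push 3 True))))) s (Suc (1 + Suc (1 + 1))) s1"
      using 1(2) by (intro runs_Branch_Cons[of _ _ x0 "x1 # w"]) (cases x0; simp)+
    then show ?thesis using False by (intro exI[of _ "Suc (1 + Suc (1 + 1))"]) (simp add: halve_step_def)
  qed
  then obtain T' where T': "runs (halve_step b) s T' s1" "T' \<le> 5" by blast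
  have "runs (halve_prog b) s (Suc (T' + T)) (s1(0 := [], 3 := rev (halve b w) @ s1 3))"
    using runs.Loop_step[OF _ T'(1) T(1)[unfolded halve_prog_def]] 1(2) by (simp add: halve_prog_def)
  moreover have "s1(0 := [], 3 := rev (halve b w) @ s1 3) = s(0 := [], 3 := rev (halve b (x0 # x1 # w)) @ s 3)"
    by (auto simp: s1_def fun_eq_iff)
  moreover have "Suc (T' + T) \<le> 6 * length (x0 # x1 # w) + 1" using T(2) T'(2) by simp
  ultimately show ?case by metis
next
  case ("2_1" b)
  then have "s(0 := [], 3 := rev (halve b []) @ s 3) = s" by auto
  moreover have "runs (halve_prog b) s 1 s"
    unfolding halve_prog_def using "2_1" by (intro runs.Loop_done)
  ultimately show ?case by (metis add_0 le_refl list.size(3) mult_0_right)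
next
  \<comment> \<open>For an unpaired bit the inner branch finds the stack empty after the pop, so
    nothing reaches stack 3.\<close>
  case ("2_2" b x0)
  define s1 where "s1 = s(0 := [])"
  have s1: "runs (Pop 0) s 1 s1" using "2_2" by (intro runs_Pop') (simp add: s1_def)
  have br: "runs (Branch 0 Skip c d) s1 (Suc 1) s1" for c d
    by (intro runs.Branch_empty runs.Skip) (simp add: s1_def)
  have sq: "runs (Seq (Pop 0) (Branch 0 Skip c d)) s (1 + Suc 1) s1" for c d
    by (rule runs.Seq[OF s1 br])
  have fin: "runs (halve_prog b) s1 1 s1"
    unfolding halve_prog_def by (intro runs.Loop_done) (simp add: s1_def)
  have ne: "s 0 \<noteq> []" using "2_2" by simp
  have eq: "s1 = s(0 := [], 3 := rev (halve b [x0]) @ s 3)" by (auto simp: s1_def)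
  show ?case
  proof (cases b)
    case True
    have "runs (halve_prog b) s (Suc ((1 + Suc 1) + 1)) s1"
      using fin unfolding halve_prog_def halve_step_def by (simp only: True if_True) (rule runs.Loop_step[OF ne sq])
    moreover have "Suc ((1 + Suc 1) + 1) \<le> 6 * length [x0] + 1" by simp
    ultimately show ?thesis unfolding eq by blast
  next
    case False
    have br2: "runs (Branch 0 Skip (Seq (Pop 0) (Branch 0 Skip c d)) (Seq (Pop 0) (Branch 0 Skip c' d'))) s (Suc (1 + Suc 1)) s1" for c d c' d'
      using "2_2" sq by (intro runs_Branch_Cons[of _ _ x0 "[]"]) auto
    have "runs (halve_prog b) s (Suc (Suc (1 + Suc 1) + 1)) s1"
      using fin unfolding halve_prog_def halve_step_def by (simp only: False if_False) (rule runs.Loop_step[OF ne br2])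
    moreover have "Suc (Suc (1 + Suc 1) + 1) \<le> 6 * length [x0] + 1" by simp
    ultimately show ?thesis unfolding eq by blast
  qed
qed

section \<open>Iterated halving along the seed\<close>

definition select :: "'a list \<Rightarrow> bool list \<Rightarrow> 'a list" where
  "select x y = foldl (\<lambda>w b. halve b w) x y"

lemma length_halve: "length (halve b w) = length w div 2"
  by (induction b w rule: halve.induct) auto

lemma nth_halve: "j < length w div 2 \<Longrightarrow> halve b w ! j = w ! (2 * j + of_bool b)"
  by (induction b w arbitrary: j rule: halve.induct) (auto simp: nth_Cons of_bool_def split: nat.splits)

lemma length_select: "length (select x y) = length x div 2 ^ length y"
  by (induction y arbitrary: x) (simp_all add: select_def length_halve div_mult2_eq)

text \<open>Undoing one halving doubles the index and adds the digit, so the digits of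
  \<open>y\<close>, least significant first, build up a residue modulo
  \<open>2 ^ length y\<close>.\<close>

lemma nth_select:
  "j < length x div 2 ^ length y \<Longrightarrow>
   select x y ! j = x ! (horner_sum of_bool 2 y + 2 ^ length y * j)"
proof (induction y arbitrary: x)
  case (Cons b y)
  let ?i = "horner_sum of_bool 2 y + 2 ^ length y * j"
  have j: "j < length (halve b x) div 2 ^ length y"
    using Cons.prems by (simp add: length_halve div_mult2_eq)
  have "horner_sum of_bool 2 y < (2::nat) ^ length y"
    by (rule horner_sum_of_bool_2_less)
  moreover have "2 ^ length y * Suc j \<le> length (halve b x)"
    using j by (metis Suc_leI less_eq_div_iff_mult_less_eq mult.commute pos2 zero_less_power)
  ultimately have "?i < length x div 2" by (simp add: length_halve)
  then show ?case
    using Cons.IH[OF j] by (simp add: select_def nth_halve algebra_simps)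
qed (simp add: select_def)

text \<open>\<open>halve_prog\<close> leaves its result reversed on stack 3, and
  \<open>move 3 0\<close> turns it round for the next seed digit.\<close>

definition select_loop :: prog where
  "select_loop = Loop 1 (Seq (Branch 1 Skip (halve_prog False) (halve_prog True)) (Seq (move 3 0) (Pop 1)))"

text \<open>Per seed digit: at most \<open>6 * length x + 1\<close> steps for halving,
  \<open>4 * length x + 1\<close> for moving back, and one each for loop test, branch and
  pop.\<close>

lemma runs_select_loop:
  assumes "s 0 = x" "s 1 = y" "s 3 = []" 
  shows "\<exists>T. runs select_loop s T (s(0 := select x y, 1 := [])) \<and> T \<le> length y * (10 * length x + 5) + 1"
  using assms
proof (induction y arbitrary: s x)
  case Nil
  then have "s(0 := select x [], 1 := []) = s" by (auto simp: fun_eq_iff select_def)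
  moreover have "runs select_loop s 1 s"
    unfolding select_loop_def using Nil by (intro runs.Loop_done) simp
  ultimately show ?case by (metis add_0 le_refl list.size(3) mult_0)
next
  case (Cons b y)
  define s1 where "s1 = s(0 := [], 3 := rev (halve b x))"
  define s2 where "s2 = s(0 := halve b x)"
  define s3 where "s3 = s(0 := halve b x, 1 := y)"
  obtain T1 where T1: "runs (halve_prog b) s T1 s1" "T1 \<le> 6 * length x + 1"
    using runs_halve_prog[of s x b] Cons.prems by (auto simp: s1_def)
  have "runs (Branch 1 Skip (halve_prog False) (halve_prog True)) s (Suc T1) s1"
    using T1 Cons.prems by (intro runs_Branch_Cons[of _ _ b y]) (cases b; simp)+
  moreover have "s1(3 := [], 0 := rev (s1 3) @ s1 0) = s2"
    using Cons.prems by (auto simp: s1_def s2_def fun_eq_iff)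
  then have "runs (move 3 0) s1 (4 * length (s1 3) + 1) s2"
    using runs_move[of 3 0 s1] by simp
  moreover have "runs (Pop 1) s2 1 s3"
    using Cons.prems by (intro runs_Pop') (auto simp: s2_def s3_def fun_eq_iff)
  ultimately have body: "runs (Seq (Branch 1 Skip (halve_prog False) (halve_prog True)) (Seq (move 3 0) (Pop 1)))
      s (Suc T1 + ((4 * length (s1 3) + 1) + 1)) s3"
    by (blast intro: runs.Seq)
  obtain T2 where T2: "runs select_loop s3 T2 (s3(0 := select (halve b x) y, 1 := []))"
     "T2 \<le> length y * (10 * length (halve b x) + 5) + 1"
    using Cons.IH[of s3 "halve b x"] Cons.prems by (metis fun_upd_other fun_upd_same s3_def zero_neq_numeral zero_neq_one one_eq_numeral_iff num.distinct(3))
  have "runs select_loop s (Suc (Suc T1 + ((4 * length (s1 3) + 1) + 1) + T2)) (s3(0 := select (halve b x) y, 1 := []))"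
    using runs.Loop_step[OF _ body T2(1)[unfolded select_loop_def]] Cons.prems by (simp add: select_loop_def)
  moreover have "s3(0 := select (halve b x) y, 1 := []) = s(0 := select x (b # y), 1 := [])"
    by (auto simp: s3_def fun_eq_iff select_def)
  moreover have "Suc (Suc T1 + ((4 * length (s1 3) + 1) + 1) + T2) \<le> length (b # y) * (10 * length x + 5) + 1"
  proof -
    have h: "length (halve b x) \<le> length x" by (simp add: length_halve)
    then have "length y * (10 * length (halve b x) + 5) \<le> length y * (10 * length x + 5)"
      by (intro mult_left_mono) auto
    moreover have "4 * length (s1 3) \<le> 4 * (length x)" using h by (simp add: s1_def)
    moreover have "length (b # y) * (10 * length x + 5) = length y * (10 * length x + 5) + (10 * length x + 5)"
      by simp
    ultimately show ?thesis using T1(2) T2(2) by linarith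
  qed
  ultimately show ?case by metis
qed

text \<open>The seed itself controls the number of passes, so one program serves all
  \<open>n\<close> and every seed length function \<open>t\<close>.\<close>

lemma explicit_family_select: "explicit_family t (\<lambda>_. select)"
  unfolding explicit_family_def
proof (rule exI, rule exI, intro allI ballI)
  fix n x y assume x: "x \<in> bitstrings n" and y: "y \<in> bitstrings (t n)"
  let ?s = "input_stacks x y" and ?w = "select x y"
  obtain T where T: "runs select_loop ?s T (?s(0 := ?w, 1 := []))"
    "T \<le> length y * (10 * length x + 5) + 1"
    using runs_select_loop[of ?s x y] by (auto simp: input_stacks_def)
  let ?s1 = "?s(0 := ?w, 1 := [])"
  \<comment> \<open>Going through stack 3 reverses the result twice.\<close>
  let ?s2 = "?s1(0 := [], 3 := rev ?w)"
  let ?s3 = "?s2(3 := [], 2 := ?w)"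
  have "?s1(0 := [], 3 := rev (?s1 0) @ ?s1 3) = ?s2" "?s2(3 := [], 2 := rev (?s2 3) @ ?s2 2) = ?s3"
    by (auto simp: input_stacks_def fun_eq_iff)
  then have "runs (move 0 3) ?s1 (4 * length ?w + 1) ?s2" "runs (move 3 2) ?s2 (4 * length ?w + 1) ?s3"
    using runs_move[of 0 3 ?s1] runs_move[of 3 2 ?s2] by simp_all
  then have R: "runs (Seq select_loop (Seq (move 0 3) (move 3 2))) ?s (T + ((4 * length ?w + 1) + (4 * length ?w + 1))) ?s3"
    by (intro runs.Seq[OF T(1)] runs.Seq) 
  let ?N = "n + t n"
  have "length y * (10 * length x + 5) \<le> ?N * (10 * ?N + 5)"
    using x y by (intro mult_mono) (auto simp: bitstrings_def)
  moreover have "length ?w \<le> ?N"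
    using x by (simp add: length_select bitstrings_def div_le_dividend trans_le_add1)
  \<comment> \<open>The coefficients come from \<open>N * (10 * N + 5) + 1\<close> for selection
    plus \<open>2 * (4 * N + 1)\<close> for the two transfers.\<close>
  ultimately have "T + ((4 * length ?w + 1) + (4 * length ?w + 1)) \<le> poly [:3, 13, 10:] ?N"
    using T(2) by (simp add: algebra_simps)
  with R show "\<exists>T s. runs (Seq select_loop (Seq (move 0 3) (move 3 2))) ?s T s \<and> T \<le> poly [:3, 13, 10:] ?N \<and> s 2 = select x y"
    by (intro exI[of _ "T + ((4 * length ?w + 1) + (4 * length ?w + 1))"] exI[of _ ?s3] conjI) auto
qed

section \<open>Boolean tests with a classical register\<close>

text \<open>The operator that \<open>E\<close> induces on the stored system when the classical
  register holds the value \<open>l\<close>.\<close>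

definition diag_block :: "nat \<Rightarrow> complex mat \<Rightarrow> nat \<Rightarrow> nat \<Rightarrow> nat \<Rightarrow> complex" where
  "diag_block d E l i j = E $$ (l * d + i, l * d + j)"

lemma sum_lessThan_mult:
  fixes f :: "nat \<Rightarrow> 'a::comm_monoid_add"
  shows "(\<Sum>k<N * d. f k) = (\<Sum>l<N. \<Sum>i<d. f (l * d + i))"
proof -
  have "(\<Sum>k<N * d. f k) = (\<Sum>l<N. sum f {l * d..<l * d + d})"
    by (rule sum.nat_group[symmetric])
  also have "\<dots> = (\<Sum>l<N. \<Sum>i<d. f (l * d + i))"
  proof (rule sum.cong[OF refl])
    show "sum f {l * d..<l * d + d} = (\<Sum>i<d. f (l * d + i))" for l
      using sum.shift_bounds_nat_ivl[of f 0 "l * d" d] by (simp add: lessThan_atLeast0 add.commute)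
  qed
  finally show ?thesis .
qed

lemma form_mat:
  assumes "A \<in> carrier_mat d d"
  shows "form d (\<lambda>i j. A $$ (i, j)) v v = (A *\<^sub>v vec d v) \<bullet>c vec d v"
  using assms
  by (auto simp: form_def scalar_prod_def lessThan_atLeast0 sum_distrib_right sum_distrib_left mult_ac
      intro!: sum.cong)

lemma psd_positive: "psd d A \<Longrightarrow> positive d (\<lambda>i j. A $$ (i, j))"
  unfolding psd_def positive_def by (simp add: form_mat)

text \<open>Embedding \<open>v\<close> at register value \<open>l\<close> transfers positivity from
  \<open>E\<close> to its diagonal blocks.\<close>

lemma form_diag_block:
  assumes "l < N"
  shows "form d (diag_block d E l) v v =
    form (N * d) (\<lambda>i j. E $$ (i, j)) (\<lambda>k. if k div d = l then v (k mod d) else 0)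
      (\<lambda>k. if k div d = l then v (k mod d) else 0)"
proof -
  have "form (N * d) (\<lambda>i j. E $$ (i, j)) (\<lambda>k. if k div d = l then v (k mod d) else 0)
      (\<lambda>k. if k div d = l then v (k mod d) else 0) =
    (\<Sum>a<N. \<Sum>i<d. \<Sum>b<N. \<Sum>j<d. (if a = l then cnj (v i) else 0) * E $$ (a * d + i, b * d + j) * (if b = l then v j else 0))"
    unfolding form_def sum_lessThan_mult
    by (intro sum.cong refl) auto
  also have "\<dots> = (\<Sum>a<N. if a = l then form d (diag_block d E l) v v else 0)"
  proof (intro sum.cong refl)
    fix a
    have "(\<Sum>b<N. \<Sum>j<d. c * E $$ (k, b * d + j) * (if b = l then v j else 0)) =
       (\<Sum>b<N. if b = l then \<Sum>j<d. c * E $$ (k, l * d + j) * v j else 0)" for c k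
      by (intro sum.cong refl) auto
    then show "(\<Sum>i<d. \<Sum>b<N. \<Sum>j<d. (if a = l then cnj (v i) else 0) * E $$ (a * d + i, b * d + j) * (if b = l then v j else 0))
       = (if a = l then form d (diag_block d E l) v v else 0)"
      using assms by (simp add: form_def diag_block_def)
  qed
  also have "\<dots> = form d (diag_block d E l) v v" using assms by simp
  finally show ?thesis ..
qed

lemma positive_diag_block:
  assumes "psd (N * d) E" "l < N"
  shows "positive d (diag_block d E l)"
  using psd_positive[OF assms(1)] unfolding positive_def form_diag_block[OF assms(2)] by blast

text \<open>The blocks of \<open>E0\<close> and \<open>E1\<close> at \<open>l\<close> add up to the
  identity, and that of \<open>E0\<close> is positive.\<close>

lemma form_diag_block_le:
  assumes "boolean_test (N * d) E0 E1" "l < N"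
  shows "Re (form d (diag_block d E1 l) v v) \<le> nsq d v"
proof -
  have dims: "E0 \<in> carrier_mat (N * d) (N * d)" "E1 \<in> carrier_mat (N * d) (N * d)"
    and sum: "E0 + E1 = 1\<^sub>m (N * d)"
    using assms(1) by (auto simp: boolean_test_def psd_def)
  have ent: "diag_block d E0 l i j + diag_block d E1 l i j = delta i j" if "i < d" "j < d" for i j
  proof -
    have "l * d + d \<le> N * d"
      using assms(2) by (metis Suc_leI add.commute mult_Suc mult_le_mono1)
    then have "l * d + i < N * d" "l * d + j < N * d" using that by simp_all
    then have "(E0 + E1) $$ (l * d + i, l * d + j) = diag_block d E0 l i j + diag_block d E1 l i j"
      "1\<^sub>m (N * d) $$ (l * d + i, l * d + j) = delta i j"
      using dims by (simp_all add: diag_block_def)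
    then show ?thesis using sum by simp
  qed
  have "form d (diag_block d E0 l) v v + form d (diag_block d E1 l) v v =
     (\<Sum>i<d. \<Sum>j<d. cnj (v i) * (diag_block d E0 l i j + diag_block d E1 l i j) * v j)"
    by (simp add: form_def sum.distrib algebra_simps)
  also have "\<dots> = (\<Sum>i<d. cnj (v i) * (\<Sum>j<d. delta i j * v j))"
    unfolding sum_distrib_left by (intro sum.cong refl) (simp add: ent mult.assoc)
  also have "\<dots> = of_real (nsq d v)"
    unfolding sum_delta_mult nsq_def of_real_sum
    by (intro sum.cong refl) (simp del: of_real_power add: complex_norm_square mult.commute)
  finally have "Re (form d (diag_block d E0 l) v v) + Re (form d (diag_block d E1 l) v v) = nsq d v"
    by (metis Re_complex_of_real plus_complex.sel(1))
  moreover have "positive d (diag_block d E0 l)"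
    using assms by (intro positive_diag_block[of N]) (auto simp: boolean_test_def)
  then have "0 \<le> Re (form d (diag_block d E0 l) v v)"
    by (auto simp: positive_def less_eq_complex_def)
  ultimately show ?thesis by simp
qed

section \<open>Outcome probabilities of mixed states\<close>

lemma outcome_prob_entries:
  assumes "E \<in> carrier_mat D D" "A \<in> carrier_mat D D"
  shows "outcome_prob E A = Re (\<Sum>i<D. \<Sum>j<D. E $$ (i, j) * A $$ (j, i))"
  using assms unfolding outcome_prob_def mat_trace_def
  by (auto simp: scalar_prod_def lessThan_atLeast0 intro!: sum.cong)

lemma outcome_prob_mixed_state:
  assumes "E \<in> carrier_mat D D" "\<And>z. z \<in> set_pmf P \<Longrightarrow> \<sigma> z \<in> carrier_mat D D"
  shows "outcome_prob E (mixed_state D P \<sigma>) = (\<Sum>z\<in>set_pmf P. pmf P z * outcome_prob E (\<sigma> z))"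
proof -
  have "outcome_prob E (mixed_state D P \<sigma>) =
      Re (\<Sum>i<D. \<Sum>j<D. \<Sum>z\<in>set_pmf P. of_real (pmf P z) * (E $$ (i, j) * \<sigma> z $$ (j, i)))"
    using assms(1) by (subst outcome_prob_entries[where D = D])
      (auto simp: mixed_state_def sum_distrib_left mult_ac intro!: sum.cong arg_cong[where f = Re])
  also have "(\<Sum>i<D. \<Sum>j<D. \<Sum>z\<in>set_pmf P. of_real (pmf P z) * (E $$ (i, j) * \<sigma> z $$ (j, i))) =
      (\<Sum>i<D. \<Sum>z\<in>set_pmf P. \<Sum>j<D. of_real (pmf P z) * (E $$ (i, j) * \<sigma> z $$ (j, i)))"
    by (intro sum.cong refl sum.swap)
  also have "\<dots> = (\<Sum>z\<in>set_pmf P. \<Sum>i<D. \<Sum>j<D. of_real (pmf P z) * (E $$ (i, j) * \<sigma> z $$ (j, i)))"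
    by (rule sum.swap)
  also have "\<dots> = (\<Sum>z\<in>set_pmf P. of_real (pmf P z) * (\<Sum>i<D. \<Sum>j<D. E $$ (i, j) * \<sigma> z $$ (j, i)))"
    by (simp add: sum_distrib_left)
  finally show ?thesis
    by (simp add: outcome_prob_entries[OF assms(1) assms(2)])
qed

text \<open>The register factor vanishes off one diagonal index, so only one block of
  \<open>E\<close> meets \<rho>.\<close>

lemma outcome_prob_tensor_basis_state:
  assumes "E \<in> carrier_mat (2 ^ length w * d) (2 ^ length w * d)" "\<rho> \<in> carrier_mat d d"
  shows "outcome_prob E (tensor_mat (basis_state w) \<rho>) =
    Re (state d (\<lambda>i j. \<rho> $$ (i, j)) (diag_block d E (horner_sum of_bool 2 w)))"
proof -
  define N l where "N = (2::nat) ^ length w" and "l = horner_sum of_bool (2::nat) w"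
  have l: "l < N" unfolding N_def l_def by (rule horner_sum_of_bool_2_less)
  let ?T = "tensor_mat (basis_state w) \<rho>"
  have T: "?T \<in> carrier_mat (N * d) (N * d)"
    using assms(2) by (simp add: tensor_mat_def basis_state_def N_def Let_def)
  have dim: "dim_row (basis_state w) = N" "dim_col (basis_state w) = N"
    by (simp_all add: basis_state_def N_def Let_def)
  have bs: "basis_state w $$ (a, b) = (if a = l \<and> b = l then 1 else 0)" if "a < N" "b < N" for a b
    using that by (simp add: basis_state_def N_def l_def Let_def)
  have ent: "?T $$ (b * d + j, a * d + i) = (if a = l then if b = l then \<rho> $$ (j, i) else 0 else 0)"
    if "a < N" "b < N" "i < d" "j < d" for a b i j
  proof -
    have "b * d + d \<le> N * d" "a * d + d \<le> N * d"
      using that by (metis Suc_leI add.commute mult_Suc mult_le_mono1)+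
    then have "b * d + j < N * d" "a * d + i < N * d" using that by simp_all
    then show ?thesis
      using that assms(2) by (simp add: tensor_mat_def dim bs)
  qed
  have "(\<Sum>i<N * d. \<Sum>j<N * d. E $$ (i, j) * ?T $$ (j, i)) =
     (\<Sum>a<N. \<Sum>i<d. \<Sum>b<N. \<Sum>j<d. E $$ (a * d + i, b * d + j) * ?T $$ (b * d + j, a * d + i))"
    unfolding sum_lessThan_mult ..
  also have "\<dots> = (\<Sum>a<N. \<Sum>i<d. \<Sum>b<N. if b = l then (if a = l then \<Sum>j<d. diag_block d E l i j * \<rho> $$ (j, i) else 0) else 0)"
    by (intro sum.cong refl) (auto simp: ent diag_block_def)
  also have "\<dots> = (\<Sum>a<N. if a = l then \<Sum>i<d. \<Sum>j<d. diag_block d E l i j * \<rho> $$ (j, i) else 0)"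
    using l by (intro sum.cong refl) (auto simp: sum.delta)
  also have "\<dots> = state d (\<lambda>i j. \<rho> $$ (i, j)) (diag_block d E l)"
    using l by (simp add: state_def)
  finally show ?thesis
    using outcome_prob_entries[OF assms(1)[folded N_def] T] by (simp add: l_def)
qed

section \<open>The uniform source and its blocks\<close>

lemma finite_bitstrings: "finite (bitstrings n)"
  using finite_lists_length_eq[of "UNIV :: bool set" n] by (simp add: bitstrings_def)

lemma card_bitstrings: "card (bitstrings n) = 2 ^ n"
  using card_lists_length_eq[of "UNIV :: bool set" n] by (simp add: bitstrings_def)

lemma bitstrings_ne: "bitstrings n \<noteq> {}"
  using card_bitstrings[of n] by (metis card.empty power_not_zero zero_neq_numeral)

text \<open>Every probability is at most \<open>1 / 2 ^ n\<close>, and both sides sum to 1 over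
  \<open>2 ^ n\<close> strings, so all these inequalities are equalities.\<close>

lemma uniform_if_min_entropy_ge:
  assumes "set_pmf X \<subseteq> bitstrings n" "min_entropy X \<ge> real n"
  shows "X = pmf_of_set (bitstrings n)"
proof -
  have fin: "finite (set_pmf X)" using assms(1) finite_bitstrings finite_subset by blast
  have le: "pmf X a \<le> 1 / 2 ^ n" for a
  proof (cases "a \<in> set_pmf X")
    case True
    then have "real n \<le> log 2 (1 / pmf X a)"
      using assms(2) fin unfolding min_entropy_def by (subst (asm) Min_ge_iff) auto
    then have "2 ^ n \<le> 1 / pmf X a"
      using True by (simp add: le_log_iff powr_realpow pmf_positive)
    then show ?thesis using pmf_positive[OF True] by (simp add: field_simps)
  qed (simp add: set_pmf_iff)
  have "(\<Sum>a\<in>bitstrings n. pmf X a) = (\<Sum>a\<in>bitstrings n. 1 / 2 ^ n)"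
    using sum_pmf_eq_1[OF finite_bitstrings assms(1)] by (simp add: card_bitstrings)
  then have eq: "pmf X a = 1 / 2 ^ n" if "a \<in> bitstrings n" for a
    using sum_mono_inv[where f = "pmf X" and g = "\<lambda>_. 1 / 2 ^ n", OF _ le that finite_bitstrings] by blast
  show ?thesis
  proof (rule pmf_eqI)
    fix a show "pmf X a = pmf (pmf_of_set (bitstrings n)) a"
      using eq[of a] assms(1) finite_bitstrings bitstrings_ne
      by (cases "a \<in> bitstrings n") (auto simp: card_bitstrings set_pmf_iff indicator_def)
  qed
qed

lemma inj_on_horner_sum: "inj_on (horner_sum of_bool (2::nat)) (bitstrings t)"
proof (rule inj_onI)
  fix y y' assume "y \<in> bitstrings t" "y' \<in> bitstrings t" "horner_sum of_bool (2::nat) y = horner_sum of_bool 2 y'"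
  then show "y = y'"
  proof (induction t arbitrary: y y')
    case (Suc t)
    then obtain a w a' w' where w: "y = a # w" "y' = a' # w'" "w \<in> bitstrings t" "w' \<in> bitstrings t"
      by (auto simp: bitstrings_def length_Suc_conv)
    let ?h = "horner_sum of_bool (2::nat)"
    have eq: "of_bool a + 2 * ?h w = of_bool a' + 2 * ?h w'" using Suc.prems(3) w by simp
    have "a = a'" using arg_cong[OF eq, of even] by (cases a; cases a') auto
    then show ?case using eq w Suc.IH[of w w'] by simp
  qed (simp add: bitstrings_def)
qed

text \<open>Position \<open>p\<close> belongs to the block with number \<open>p mod 2 ^ t\<close>
  and has index \<open>p div 2 ^ t\<close> there. Positions with quotient at least \<open>m\<close>
  form a leftover tail that resampling leaves alone.\<close>

lemma independent_blocks_select: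
  assumes "m = n div 2 ^ t"
  shows "independent_blocks (bitstrings n) (bitstrings t) (bitstrings m) select
    (\<lambda>y z x. map (\<lambda>p. if p mod 2 ^ t = horner_sum of_bool 2 y \<and> p div 2 ^ t < m
       then z ! (p div 2 ^ t) else x ! p) [0..<n])" (is "independent_blocks _ _ _ _ ?upd")
proof
  let ?h = "horner_sum of_bool (2::nat)"
  show "select x y \<in> bitstrings m" if "x \<in> bitstrings n" "y \<in> bitstrings t" for x y :: "bool list"
    using that by (simp add: bitstrings_def length_select assms)
  fix x y z :: "bool list" assume x: "x \<in> bitstrings n" and y: "y \<in> bitstrings t" and z: "z \<in> bitstrings m"
  show "?upd y z x \<in> bitstrings n" by (simp add: bitstrings_def)
  have idx: "?h y' + 2 ^ t * j < n" "(?h y' + 2 ^ t * j) mod 2 ^ t = ?h y'" "(?h y' + 2 ^ t * j) div 2 ^ t = j"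
    if "y' \<in> bitstrings t" "j < m" for y' j
  proof -
    have h: "?h y' < 2 ^ t" using that horner_sum_of_bool_2_less[of y'] by (simp add: bitstrings_def)
    then show "(?h y' + 2 ^ t * j) mod 2 ^ t = ?h y'" "(?h y' + 2 ^ t * j) div 2 ^ t = j" by simp_all
    have "2 ^ t * Suc j \<le> n"
      using that(2) unfolding assms by (metis Suc_leI less_eq_div_iff_mult_less_eq mult.commute pos2 zero_less_power)
    then show "?h y' + 2 ^ t * j < n" using h by simp
  qed
  have nth_upd: "?upd y z x ! k = (if k mod 2 ^ t = ?h y \<and> k div 2 ^ t < m then z ! (k div 2 ^ t) else x ! k)"
    if "k < n" for k using that by simp
  have sel: "select v y' ! j = v ! (?h y' + 2 ^ t * j)"
    if "v \<in> bitstrings n" "y' \<in> bitstrings t" "j < m" for v :: "bool list" and y' j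
    using that nth_select[of j v y'] by (simp add: bitstrings_def assms)
  show "select (?upd y z x) y' = (if y' = y then z else select x y')" if y': "y' \<in> bitstrings t" for y'
  proof (rule nth_equalityI)
    show "length (select (?upd y z x) y') = length (if y' = y then z else select x y')"
      using x z y' by (simp add: length_select bitstrings_def assms)
    fix j assume "j < length (select (?upd y z x) y')"
    then have j: "j < m" using y' by (simp add: length_select bitstrings_def assms)
    have "select (?upd y z x) y' ! j = (if ?h y' = ?h y then z ! j else x ! (?h y' + 2 ^ t * j))"
      unfolding sel[OF \<open>?upd y z x \<in> bitstrings n\<close> y' j] nth_upd[OF idx(1)[OF y' j]] idx(2,3)[OF y' j]
      using j by simp
    also have "?h y' = ?h y \<longleftrightarrow> y' = y"
      using inj_on_horner_sum[of t] y y' by (auto dest: inj_onD)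
    finally show "select (?upd y z x) y' ! j = (if y' = y then z else select x y') ! j"
      using sel[OF x y' j] by simp
  qed
  show "?upd y (select x y) (?upd y z x) = x"
  proof (rule nth_equalityI)
    show "length (?upd y (select x y) (?upd y z x)) = length x" using x by (simp add: bitstrings_def)
    fix p assume "p < length (?upd y (select x y) (?upd y z x))"
    then have p: "p < n" by simp
    show "?upd y (select x y) (?upd y z x) ! p = x ! p"
    proof (cases "p mod 2 ^ t = ?h y \<and> p div 2 ^ t < m")
      case True
      then have "select x y ! (p div 2 ^ t) = x ! (p mod 2 ^ t + 2 ^ t * (p div 2 ^ t))"
        using sel[OF x y] by simp
      also have "p mod 2 ^ t + 2 ^ t * (p div 2 ^ t) = p" by (rule mod_mult_div_eq)
      finally have "select x y ! (p div 2 ^ t) = x ! p" .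
      then show ?thesis using True p by simp
    qed (use p in auto)
  qed
qed (use finite_bitstrings bitstrings_ne in auto)

section \<open>The advantage of a test against bit selection\<close>

lemma sum_bitstrings_append:
  "(\<Sum>w\<in>bitstrings (t + m). f w) = (\<Sum>y\<in>bitstrings t. \<Sum>z\<in>bitstrings m. f (y @ z))"
  unfolding sum.cartesian_product
  by (rule sum.reindex_bij_witness[of _ "\<lambda>(y, z). y @ z" "\<lambda>w. (take t w, drop t w)"])
    (auto simp: bitstrings_def)

lemma positive_hermitian:
  assumes "positive d A"
  shows "hermitian d A"
proof -
  have "A j i = cnj (A i j)" if "i < d" "j < d" for i j
    using positive_form_cnj[OF assms, of "delta j" "delta i"] that by (simp add: form_delta)
  then show ?thesis unfolding hermitian_def by blast
qed

lemma sum_rotate: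
  fixes f :: "'a \<Rightarrow> 'b \<Rightarrow> 'c \<Rightarrow> 'd::comm_monoid_add"
  shows "(\<Sum>i\<in>A. \<Sum>j\<in>B. \<Sum>k\<in>C. f i j k) = (\<Sum>k\<in>C. \<Sum>i\<in>A. \<Sum>j\<in>B. f i j k)"
proof -
  have "(\<Sum>i\<in>A. \<Sum>j\<in>B. \<Sum>k\<in>C. f i j k) = (\<Sum>i\<in>A. \<Sum>k\<in>C. \<Sum>j\<in>B. f i j k)"
    by (intro sum.cong refl sum.swap)
  also have "\<dots> = (\<Sum>k\<in>C. \<Sum>i\<in>A. \<Sum>j\<in>B. f i j k)" by (rule sum.swap)
  finally show ?thesis .
qed

lemma nsq_diff_le: "nsq d (\<lambda>i. u i - v i) \<le> 2 * nsq d u + 2 * nsq d v"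
proof -
  have "(cmod (a - b))\<^sup>2 \<le> 2 * (cmod a)\<^sup>2 + 2 * (cmod b)\<^sup>2" for a b
  proof -
    have "(cmod (a - b))\<^sup>2 \<le> (cmod a + cmod b)\<^sup>2"
      by (intro power_mono norm_triangle_ineq4) simp
    also have "\<dots> \<le> 2 * (cmod a)\<^sup>2 + 2 * (cmod b)\<^sup>2"
      using sum_squares_ge_zero[of "cmod a - cmod b" 0] by (simp add: power2_eq_square algebra_simps)
    finally show ?thesis .
  qed
  then show ?thesis
    unfolding nsq_def sum_distrib_left sum.distrib[symmetric] by (intro sum_mono)
qed

text \<open>The advantage is rewritten as a mean over source and seed of centred effects on the
  stored state, to which \<open>mean_state_le\<close> applies with \<open>2 ^ q\<close> as the
  moment parameter.\<close>

lemma select_strong_quantum_extractor: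
  assumes m: "m = n div 2 ^ t" and b: "b \<le> 2 ^ q" and q: "q \<le> t"
    and \<epsilon>: "0 < \<epsilon>" "24 * 2 ^ q / 2 ^ t < \<epsilon>\<^sup>2"
  shows "strong_quantum_extractor n t m (real n) b \<epsilon> select"
  unfolding strong_quantum_extractor_def
proof (intro conjI ballI allI impI)
  interpret B: independent_blocks "bitstrings n" "bitstrings t" "bitstrings m" select
    "\<lambda>y z x. map (\<lambda>p. if p mod 2 ^ t = horner_sum of_bool 2 y \<and> p div 2 ^ t < m
       then z ! (p div 2 ^ t) else x ! p) [0..<n]"
    by (rule independent_blocks_select[OF m])
  show "select x y \<in> bitstrings m" if "x \<in> bitstrings n" "y \<in> bitstrings t" for x y :: "bool list"
    using that by (rule B.block)
  fix X \<rho> assume asm: "set_pmf X \<subseteq> bitstrings n \<and> min_entropy X \<ge> real n \<and> quantum_encoding n b \<rho>"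
  define d :: nat where "d = 2 ^ b"
  define N :: nat where "N = 2 ^ (t + m)"
  let ?h = "horner_sum of_bool (2::nat)"
  have X: "X = pmf_of_set (bitstrings n)" using asm uniform_if_min_entropy_ge by blast
  have dens: "density_matrix d (\<rho> x)" if "x \<in> bitstrings n" for x
    using asm that by (simp add: quantum_encoding_def d_def)
  have \<rho>: "\<rho> x \<in> carrier_mat d d" "positive d (\<lambda>i j. \<rho> x $$ (i, j))" "(\<Sum>i<d. \<rho> x $$ (i, i)) = 1"
    if "x \<in> bitstrings n" for x
    using dens[OF that] psd_positive[of d "\<rho> x"] by (auto simp: density_matrix_def psd_def mat_trace_def)
  show "indistinguishable (2 ^ (t + m) * 2 ^ b) \<epsilon> (extractor_output_state t m b select X \<rho>) (uniform_output_state t m b X \<rho>)"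
    unfolding indistinguishable_def
  proof (rule notI, elim exE conjE)
    fix E0 E1 assume test: "boolean_test (2 ^ (t + m) * 2 ^ b) E0 E1"
      and dist: "distinguishes \<epsilon> E1 (extractor_output_state t m b select X \<rho>) (uniform_output_state t m b X \<rho>)"
    note test = test[folded N_def d_def]
    have E1: "E1 \<in> carrier_mat (N * d) (N * d)" "psd (N * d) E1"
      using test by (auto simp: boolean_test_def psd_def)
    \<comment> \<open>Given the classical string \<open>w\<close>, the test acts on the stored state
      through the effect \<open>M w\<close>.\<close>
    define M where "M w = diag_block d E1 (?h w)" for w
    define P where "P x w = Re (state d (\<lambda>i j. \<rho> x $$ (i, j)) (M w))" for x w
    have hN: "?h w < N" if "w \<in> bitstrings (t + m)" for w
      using that horner_sum_of_bool_2_less[of w] by (simp add: bitstrings_def N_def)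
    have prob: "outcome_prob E1 (tensor_mat (basis_state w) (\<rho> x)) = P x w"
      "tensor_mat (basis_state w) (\<rho> x) \<in> carrier_mat (N * d) (N * d)"
      if "x \<in> bitstrings n" "w \<in> bitstrings (t + m)" for x w
      using that outcome_prob_tensor_basis_state[of E1 w d "\<rho> x"] E1(1) \<rho>(1)[OF that(1)]
      by (auto simp: P_def M_def bitstrings_def N_def tensor_mat_def basis_state_def Let_def)
    have setX: "set_pmf X = bitstrings n" unfolding X by (intro set_pmf_of_set finite_bitstrings bitstrings_ne)
    have pmfU: "pmf (pmf_of_set (bitstrings k)) a = 1 / 2 ^ k" if "a \<in> bitstrings k" for k a
      using that finite_bitstrings bitstrings_ne by (simp add: card_bitstrings)
    have setU: "set_pmf (pmf_of_set (bitstrings k)) = bitstrings k" for k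
      by (intro set_pmf_of_set finite_bitstrings bitstrings_ne)
    have app: "y @ z \<in> bitstrings (t + m)" if "y \<in> bitstrings t" "z \<in> bitstrings m" for y z :: "bool list"
      using that by (simp add: bitstrings_def)
    have ext: "outcome_prob E1 (extractor_output_state t m b select X \<rho>) =
       (\<Sum>x\<in>bitstrings n. \<Sum>y\<in>bitstrings t. P x (y @ select x y)) / 2 ^ n / 2 ^ t"
    proof -
      have "outcome_prob E1 (extractor_output_state t m b select X \<rho>) =
        (\<Sum>(x, y)\<in>bitstrings n \<times> bitstrings t. pmf (pair_pmf X (pmf_of_set (bitstrings t))) (x, y) * P x (y @ select x y))"
        unfolding extractor_output_state_def N_def[symmetric] d_def[symmetric]
        by (subst outcome_prob_mixed_state[OF E1(1)])
          (auto simp: setX setU prob app B.block intro!: sum.cong)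
      also have "\<dots> = (\<Sum>(x, y)\<in>bitstrings n \<times> bitstrings t. P x (y @ select x y) / 2 ^ n / 2 ^ t)"
        by (intro sum.cong refl) (auto simp: pmf_pair X pmfU simp del: pmf_of_set)
      finally show ?thesis by (simp add: sum.cartesian_product[symmetric] sum_divide_distrib)
    qed
    have uni: "outcome_prob E1 (uniform_output_state t m b X \<rho>) =
       (\<Sum>x\<in>bitstrings n. \<Sum>y\<in>bitstrings t. (\<Sum>z\<in>bitstrings m. P x (y @ z)) / 2 ^ m) / 2 ^ n / 2 ^ t"
    proof -
      have "outcome_prob E1 (uniform_output_state t m b X \<rho>) =
        (\<Sum>(x, w)\<in>bitstrings n \<times> bitstrings (t + m). pmf (pair_pmf X (pmf_of_set (bitstrings (t + m)))) (x, w) * P x w)"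
        unfolding uniform_output_state_def N_def[symmetric] d_def[symmetric]
        by (subst outcome_prob_mixed_state[OF E1(1)])
          (auto simp: setX setU prob intro!: sum.cong)
      also have "\<dots> = (\<Sum>(x, w)\<in>bitstrings n \<times> bitstrings (t + m). P x w / 2 ^ m / 2 ^ n / 2 ^ t)"
        by (intro sum.cong refl) (auto simp: pmf_pair X pmfU power_add simp del: pmf_of_set)
      finally show ?thesis
        by (simp add: sum.cartesian_product[symmetric] sum_bitstrings_append sum_divide_distrib)
    qed
    \<comment> \<open>Uniform output replaces \<open>M (y @ z)\<close> by its mean over
      \<open>z\<close>; subtracting this mean gives centred letters.\<close>
    define M' where "M' y i j = (\<Sum>z\<in>bitstrings m. M (y @ z) i j) / 2 ^ m" for y i j
    define D where "D y z i j = M (y @ z) i j - M' y i j" for y z i j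
    have state_D: "Re (state d (\<lambda>i j. \<rho> x $$ (i, j)) (\<lambda>i j. \<Sum>y\<in>bitstrings t. D y (select x y) i j)) =
       (\<Sum>y\<in>bitstrings t. P x (y @ select x y) - (\<Sum>z\<in>bitstrings m. P x (y @ z)) / 2 ^ m)" for x
    proof -
      have st_sum: "state d \<rho>' (\<lambda>i j. \<Sum>a\<in>A. F a i j) = (\<Sum>a\<in>A. state d \<rho>' (F a))"
        for \<rho>' and A :: "bool list set" and F
        unfolding state_def sum_distrib_right
        by (rule sum_rotate)
      have st_D: "state d \<rho>' (D y z) = state d \<rho>' (M (y @ z)) - state d \<rho>' (M' y)" for \<rho>' y z
        by (simp add: state_def D_def left_diff_distrib sum_subtractf)
      have st_M': "state d \<rho>' (M' y) = (\<Sum>z\<in>bitstrings m. state d \<rho>' (M (y @ z))) / 2 ^ m" for \<rho>' y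
        unfolding st_sum[symmetric] unfolding state_def M'_def sum_divide_distrib[where A = "{..<d}"] by simp
      have "Re ((\<Sum>z\<in>bitstrings m. state d \<rho>' (M (y @ z))) / 2 ^ m) = (\<Sum>z\<in>bitstrings m. Re (state d \<rho>' (M (y @ z)))) / 2 ^ m" for \<rho>' y
        using Re_divide_of_real[of _ "2 ^ m"] by simp
      then show ?thesis by (simp add: st_sum st_D st_M' P_def)
    qed
    let ?adv = "outcome_prob E1 (extractor_output_state t m b select X \<rho>) -
      outcome_prob E1 (uniform_output_state t m b X \<rho>)"
    have "?adv =
      (\<Sum>x\<in>bitstrings n. Re (state d (\<lambda>i j. \<rho> x $$ (i, j)) (\<lambda>i j. \<Sum>y\<in>bitstrings t. D y (select x y) i j)))
        / card (bitstrings n) / card (bitstrings t)"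
      unfolding ext uni state_D by (simp add: card_bitstrings sum_subtractf diff_divide_distrib)
    moreover have "(\<dots>)\<^sup>2 \<le> 24 * 2 ^ q / card (bitstrings t)"
    proof (rule B.mean_state_le)
      have Mpos: "positive d (M w)" "Re (form d (M w) v v) \<le> nsq d v" if "w \<in> bitstrings (t + m)" for w v
        using positive_diag_block[OF E1(2) hN[OF that]] form_diag_block_le[OF test hN[OF that]]
        by (simp_all add: M_def)
      have form_M': "form d (M' y) v v = (\<Sum>z\<in>bitstrings m. form d (M (y @ z)) v v) / of_real (2 ^ m)" for y v
      proof -
        have "form d (M' y) v v = (\<Sum>i<d. \<Sum>j<d. \<Sum>z\<in>bitstrings m. cnj (v i) * M (y @ z) i j * v j / 2 ^ m)"
          by (simp add: form_def M'_def sum_distrib_left sum_distrib_right sum_divide_distrib)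
        also have "\<dots> = (\<Sum>z\<in>bitstrings m. form d (M (y @ z)) v v / 2 ^ m)"
          unfolding form_def sum_divide_distrib
          by (rule sum_rotate)
        finally show ?thesis by (simp add: sum_divide_distrib)
      qed
      have M'pos: "positive d (M' y)" if y: "y \<in> bitstrings t" for y
        unfolding positive_def form_M'
      proof
        fix v
        have "0 \<le> (\<Sum>z\<in>bitstrings m. form d (M (y @ z)) v v)"
          using Mpos(1) app[OF y] by (intro sum_nonneg) (auto simp: positive_def)
        then show "0 \<le> (\<Sum>z\<in>bitstrings m. form d (M (y @ z)) v v) / of_real (2 ^ m)"
          unfolding less_eq_complex_def Re_divide_of_real Im_divide_of_real by simp
      qed
      have M'le: "Re (form d (M' y) v v) \<le> nsq d v" if y: "y \<in> bitstrings t" for y v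
      proof -
        have "(\<Sum>z\<in>bitstrings m. Re (form d (M (y @ z)) v v)) \<le> (\<Sum>z\<in>bitstrings m. nsq d v)"
          using Mpos(2) app[OF y] by (intro sum_mono) auto
        then show ?thesis
          unfolding form_M' Re_divide_of_real Re_sum by (simp add: card_bitstrings field_simps)
      qed
      show "(\<Sum>z\<in>bitstrings m. D y z i j) = 0" for y i j
        by (simp add: D_def M'_def sum_subtractf card_bitstrings)
      show "nsq d (app d (D y z) v) \<le> 2\<^sup>2 * nsq d v" if y: "y \<in> bitstrings t" and z: "z \<in> bitstrings m" for y z v
      proof -
        \<comment> \<open>Both \<open>M (y @ z)\<close> and its mean \<open>M' y\<close> lie between
          zero and the identity, hence do not increase norms; \<open>nsq_diff_le\<close> then yields
          \<open>2 + 2 = 2^2\<close>.\<close>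
        have "app d (D y z) v = (\<lambda>i. app d (M (y @ z)) v i - app d (M' y) v i)"
          by (simp add: app_def D_def left_diff_distrib sum_subtractf fun_eq_iff)
        then have "nsq d (app d (D y z) v) \<le> 2 * nsq d (app d (M (y @ z)) v) + 2 * nsq d (app d (M' y) v)"
          using nsq_diff_le by simp
        also have "\<dots> \<le> 2 * nsq d v + 2 * nsq d v"
          using Mpos app[OF y z] M'pos[OF y] M'le[OF y]
          by (intro add_mono mult_left_mono nsq_app_le) auto
        finally show ?thesis by simp
      qed
      show "hermitian d (D y z)" if y: "y \<in> bitstrings t" and z: "z \<in> bitstrings m" for y z
      proof -
        have "hermitian d (M (y @ z))" "hermitian d (M' y)"
          using Mpos(1)[OF app[OF y z]] M'pos[OF y] by (simp_all add: positive_hermitian)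
        then have "D y z j i = cnj (D y z i j)" if "i < d" "j < d" for i j
          using that by (simp add: D_def hermitianD)
        then show ?thesis unfolding hermitian_def by blast
      qed
      show "2 ^ q \<le> card (bitstrings t)" using q by (simp add: card_bitstrings)
      show "d \<le> 2 ^ 2 ^ q" using b by (simp add: d_def)
    qed (use \<rho> in auto)
    ultimately have "?adv\<^sup>2 \<le> 24 * 2 ^ q / 2 ^ t"
      by (simp add: card_bitstrings)
    \<comment> \<open>Strictness matters: an advantage of exactly \<epsilon> already counts as
      distinguishing.\<close>
    also have "\<dots> < \<epsilon>\<^sup>2" by (rule \<epsilon>(2))
    finally have "\<bar>?adv\<bar>\<^sup>2 < \<epsilon>\<^sup>2"
      by (simp only: power2_abs)
    then have "\<bar>?adv\<bar> < \<epsilon>"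
      using less_imp_le[OF \<epsilon>(1)] by (rule power2_less_imp_less)
    then show False using dist by (simp add: distinguishes_def)
  qed
qed

section \<open>Parameters\<close>

text \<open>Rounding the exponent down loses less than a factor 2 in the number of blocks.\<close>

lemma seed_length_bounds:
  assumes "n \<ge> 1" "0 \<le> a" 
  defines "t \<equiv> nat \<lfloor>a * log 2 (real n)\<rfloor>"
  shows "2 ^ t \<le> real n powr a" "real n powr a < 2 * 2 ^ t" "real t \<le> a * log 2 (real n)"
proof -
  have nn: "0 \<le> a * log 2 (real n)" using assms by simp
  have exp: "2 powr (a * log 2 (real n)) = real n powr a"
    using assms(1) by (simp add: powr_powr[symmetric] mult.commute[of a])
  show le: "real t \<le> a * log 2 (real n)" using nn by (simp add: t_def)
  have "2 ^ t = 2 powr real t" by (simp add: powr_realpow)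
  also have "\<dots> \<le> 2 powr (a * log 2 (real n))" using le by simp
  finally show "2 ^ t \<le> real n powr a" by (simp add: exp)
  have "a * log 2 (real n) < real t + 1" using nn unfolding t_def by linarith
  then have "2 powr (a * log 2 (real n)) < 2 powr (real t + 1)" by simp
  also have "\<dots> = 2 * 2 ^ t" by (simp add: powr_add powr_realpow)
  finally show "real n powr a < 2 * 2 ^ t" by (simp add: exp)
qed

theorem corollary1p1:
  shows "\<exists>c::real. c > 1 \<and> c = 15 \<and>
    (\<forall>\<beta> \<gamma> :: real. 0 \<le> \<beta> \<and> \<beta> < 1 \<and> \<gamma> < (1 - \<beta>) / c \<longrightarrow>
      (\<exists>(E :: nat \<Rightarrow> bool list \<Rightarrow> bool list \<Rightarrow> bool list) (t :: nat \<Rightarrow> nat) (m :: nat \<Rightarrow> nat).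
         explicit_family t E \<and>
         (\<lambda>n. real (t n)) \<in> O(\<lambda>n. log 2 (real n)) \<and>
         (\<exists>\<delta>>0. \<forall>\<^sub>F n in sequentially. real (m n) \<ge> real n powr \<delta>) \<and>
         (\<forall>\<^sub>F n in sequentially.
            strong_quantum_extractor n (t n) (m n) (real n)
              (nat \<lfloor>real n powr \<beta>\<rfloor>) (real n powr - \<gamma>) (E n))))"
proof (intro exI[of _ 15] conjI allI impI)
  fix \<beta> \<gamma> :: real assume asm: "0 \<le> \<beta> \<and> \<beta> < 1 \<and> \<gamma> < (1 - \<beta>) / 15"
  \<comment> \<open>With about \<open>n powr (1 - \<delta>)\<close> blocks, the block length and the
    inverse of the squared error both have order \<open>n powr \<delta>\<close>; the hypothesis on
    \<gamma> gives \<open>2 * \<gamma> < \<delta>\<close>.\<close>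
  define \<delta> where "\<delta> = (1 - \<beta>) / 2"
  have \<delta>: "0 < \<delta>" "\<delta> \<le> 1/2" "2 * \<gamma> < \<delta>" "\<beta> - (1 - \<delta>) = - \<delta>"
    using asm by (auto simp: \<delta>_def field_simps)
  define t where "t n = nat \<lfloor>(1 - \<delta>) * log 2 (real n)\<rfloor>" for n
  define m where "m n = n div 2 ^ t n" for n
  note t_bounds = seed_length_bounds[of _ "1 - \<delta>", folded t_def]
  have "(\<lambda>n. real (t n)) \<in> O(\<lambda>n. log 2 (real n))"
  proof (intro bigoI[of _ 1] eventually_mono[OF eventually_ge_at_top[of 1]])
    fix n :: nat assume n: "n \<ge> 1"
    then have "real (t n) \<le> (1 - \<delta>) * log 2 (real n)" using t_bounds(3) \<delta> by simp
    also have "\<dots> \<le> 1 * log 2 (real n)" using \<delta> n by (intro mult_right_mono) auto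
    finally show "norm (real (t n)) \<le> 1 * norm (log 2 (real n))" by simp
  qed
  moreover have "\<forall>\<^sub>F n in sequentially. real (m n) \<ge> real n powr (\<delta> / 2)"
  proof -
    \<comment> \<open>Integer division costs at most 1, which halving the exponent absorbs.\<close>
    have "\<forall>\<^sub>F n in sequentially. real n powr \<delta> - 1 \<ge> real n powr (\<delta> / 2)"
      using \<delta>(1) by real_asymp
    then show ?thesis
      using eventually_ge_at_top[of 1]
    proof eventually_elim
      case (elim n)
      have "real n powr \<delta> = real n / real n powr (1 - \<delta>)"
        using elim by (simp add: powr_diff field_simps)
      also have "\<dots> \<le> real n / 2 ^ t n"
        using t_bounds(1)[of n] \<delta> elim by (intro divide_left_mono) auto
      also have "\<dots> \<le> real (m n) + 1"
      proof -
        have "n < 2 ^ t n + 2 ^ t n * m n" unfolding m_def by (rule dividend_less_times_div) simp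
        then have "real n < real (2 ^ t n + 2 ^ t n * m n)" by (simp only: of_nat_less_iff)
        then show ?thesis by (simp add: divide_le_eq algebra_simps)
      qed
      finally show ?case using elim by simp
    qed
  qed
  moreover have "\<forall>\<^sub>F n in sequentially. strong_quantum_extractor n (t n) (m n) (real n)
      (nat \<lfloor>real n powr \<beta>\<rfloor>) (real n powr - \<gamma>) select"
  proof -
    \<comment> \<open>\<open>96 = 24 * 4\<close>: one factor 2 comes from rounding \<open>b\<close>
      up to a power of two, the other from rounding the seed length.\<close>
    have "\<forall>\<^sub>F n in sequentially. 96 * real n powr - \<delta> < real n powr (- (2 * \<gamma>))"
      using \<delta>(3) by real_asymp
    \<comment> \<open>This makes the moment parameter smaller than the number of blocks.\<close>
    moreover have "\<forall>\<^sub>F n in sequentially. 96 * real n powr - \<delta> < 1"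
      using \<delta>(1) by real_asymp
    ultimately show ?thesis
      using eventually_ge_at_top[of 1]
    proof eventually_elim
      case (elim n)
      define b where "b = nat \<lfloor>real n powr \<beta>\<rfloor>"
      have "1 \<le> real n powr \<beta>" using elim asm by (simp add: ge_one_powr_ge_zero)
      then have b: "b \<ge> 1" "real b \<le> real n powr \<beta>" unfolding b_def by linarith+
      \<comment> \<open>The moment parameter will be \<open>2 ^ (q + 1)\<close>, a power of two
        above \<open>b\<close> but at most \<open>2 * b\<close>.\<close>
      obtain q where q: "2 ^ q \<le> b" "b < 2 ^ (q + 1)" using ex_power_ivl1[of 2 b] b by auto
      have "2 ^ q \<le> real b" using q(1) by (metis of_nat_le_iff of_nat_numeral of_nat_power)
      with b(2) have "2 ^ q \<le> real n powr \<beta>" by linarith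
      then have "2 ^ (q + 1) \<le> 2 * real n powr \<beta>" by simp
      then have "2 ^ (q + 1) / 2 ^ t n \<le> 2 * real n powr \<beta> / 2 ^ t n"
        by (rule divide_right_mono) simp
      also have "\<dots> \<le> 2 * real n powr \<beta> / (real n powr (1 - \<delta>) / 2)"
        using t_bounds(2)[of n] \<delta> elim by (intro divide_left_mono) auto
      also have "\<dots> = 4 * real n powr - \<delta>"
        unfolding \<delta>(4)[symmetric] powr_diff by simp
      finally have ratio: "2 ^ (q + 1) / 2 ^ t n \<le> 4 * real n powr - \<delta>" .
      also have "\<dots> < 1" using elim by simp
      finally have "(2::real) ^ (q + 1) < 2 ^ t n" by (simp only: divide_less_eq_1) simp
      then have "q + 1 \<le> t n" using power_less_imp_less_exp[of "2::real" "q + 1" "t n"] by simp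
      moreover have "24 * 2 ^ (q + 1) / 2 ^ t n < (real n powr - \<gamma>)\<^sup>2"
      proof -
        have "24 * 2 ^ (q + 1) / 2 ^ t n \<le> 96 * real n powr - \<delta>" using ratio by simp
        also have "\<dots> < (real n powr - \<gamma>)\<^sup>2" using elim by (simp add: powr_power)
        finally show ?thesis .
      qed
      ultimately show ?case
        using q(2) elim by (fold b_def) (intro select_strong_quantum_extractor[where q = "q + 1"], auto simp: m_def)
    qed
  qed
  ultimately show "\<exists>(E :: nat \<Rightarrow> bool list \<Rightarrow> bool list \<Rightarrow> bool list) (t :: nat \<Rightarrow> nat) (m :: nat \<Rightarrow> nat).
         explicit_family t E \<and>
         (\<lambda>n. real (t n)) \<in> O(\<lambda>n. log 2 (real n)) \<and>
         (\<exists>\<delta>>0. \<forall>\<^sub>F n in sequentially. real (m n) \<ge> real n powr \<delta>) \<and>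
         (\<forall>\<^sub>F n in sequentially.
            strong_quantum_extractor n (t n) (m n) (real n)
              (nat \<lfloor>real n powr \<beta>\<rfloor>) (real n powr - \<gamma>) (E n))"
    using explicit_family_select[of t] \<delta>(1)
    by (intro exI[of _ "\<lambda>_. select"] exI[of _ t] exI[of _ m] conjI exI[of _ "\<delta> / 2"]) auto
qed simp_all

end
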